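(* With $\mathcal U^{s,t}:=\{f\in\Omega:\ -f(-t)\ge b+c_2t,\ f(-s)-f(-t)\ge b+c_2t-c_1s\}$, $$J\ \ge\ \inf_{t>t_0}\ \sup_{s\in(0,t)}\ \inf_{f\in\mathcal U^{s,t}}I(f).$$
   Context: Let $v:[0,\infty)\to[0,\infty)$ be continuous with $v(0)=0$ and $\lim_{t\to\infty}v(t)/t^{\alpha}=0$ for some $\alpha<2$. Let $A=(A(t))_{t\in\mathbb R}$ be a centered Gaussian process with continuous sample paths, $A(0)=0$, stationary increments and $\mathrm{Var}(A(t)-A(s))=v(|t-s|)$; write $A(s,t):=A(t)-A(s)$ and $\Gamma(s,t):=\tfrac12\big(v(|s|)+v(|t|)-v(|t-s|)\big)$ for $s,t\in\mathbb R$. Let $A_1,A_2,\dots$ be i.i.d. copies of $A$. $\Omega$ is the set of continuous $\omega:\mathbb R\to\mathbb R$ with $\omega(0)=0$ and $\omega(t)/(1+|t|)\to0$ as $t\to\pm\infty$, normed by $\|\omega\|_\Omega:=\sup_t|\omega(t)|/(1+|t|)$. $R\subseteq\Omega$ is the reproducing kernel Hilbert space of $\Gamma$ (closure of the span of $\{\Gamma(s,\cdot)\}$ under $\langle\Gamma(s,\cdot),\Gamma(u,\cdot)\rangle_R=\Gamma(s,u)$), and $I(\omega):=\frac12\|\omega\|_R^2$ for $\omega\in R$, $I(\omega):=\infty$ otherwise. Fix $b>0$, $c_1>c_2>0$, $t_0:=b/(c_1-c_2)$, let $$Q_{2,n}:=\sup_{t>0}\Big(\sum_{i=1}^nA_i(-t,0)-nc_2t\Big)-\sup_{s>0}\Big(\sum_{i=1}^nA_i(-s,0)-nc_1s\Big),$$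 and $J:=-\lim_{n\to\infty}\frac1n\log\mathbb P(Q_{2,n}>nb)$ (this limit exists). *)

theory Defs
  imports "HOL-Probability.Probability"
begin

definition Gam :: "(real \<Rightarrow> real) \<Rightarrow> real \<Rightarrow> real \<Rightarrow> real" where
  "Gam v s t = (v \<bar>s\<bar> + v \<bar>t\<bar> - v \<bar>t - s\<bar>) / 2"

text \<open>Centered (possibly degenerate) Gaussian real random variable with variance sigma2,
  characterised by its characteristic function.\<close>
definition centered_gaussian_rv :: "'a measure \<Rightarrow> ('a \<Rightarrow> real) \<Rightarrow> real \<Rightarrow> bool" where
  "centered_gaussian_rv M X sigma2 \<longleftrightarrow>
     X \<in> borel_measurable M \<and>
     (\<forall>u. char (distr M borel X) u = complex_of_real (exp (- (u\<^sup>2 * sigma2) / 2)))"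

definition centered_gaussian_process ::
  "'a measure \<Rightarrow> ('a \<Rightarrow> real \<Rightarrow> real) \<Rightarrow> (real \<Rightarrow> real \<Rightarrow> real) \<Rightarrow> bool" where
  "centered_gaussian_process M X K \<longleftrightarrow>
     (\<forall>cs :: (real \<times> real) list.
        centered_gaussian_rv M (\<lambda>\<omega>. \<Sum>(t, c)\<leftarrow>cs. c * X \<omega> t)
          (\<Sum>(t, c)\<leftarrow>cs. \<Sum>(u, d)\<leftarrow>cs. c * d * K t u))"

definition Omega :: "(real \<Rightarrow> real) set" where
  "Omega = {w. continuous_on UNIV w \<and> w 0 = 0 \<and>
              ((\<lambda>t. w t / (1 + \<bar>t\<bar>)) \<longlongrightarrow> 0) at_top \<and>
              ((\<lambda>t. w t / (1 + \<bar>t\<bar>)) \<longlongrightarrow> 0) at_bot}"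

text \<open>Elements of span{Gamma(s,.)} are given by lists of pairs (s, a), meaning
  sum a * Gamma(s,.); pre-inner product <Gamma(s,.),Gamma(u,.)> = Gamma(s,u).\<close>
definition span_fun :: "(real \<Rightarrow> real \<Rightarrow> real) \<Rightarrow> (real \<times> real) list \<Rightarrow> real \<Rightarrow> real" where
  "span_fun K xs t = (\<Sum>(s, a)\<leftarrow>xs. a * K s t)"

definition span_inner :: "(real \<Rightarrow> real \<Rightarrow> real) \<Rightarrow> (real \<times> real) list \<Rightarrow> (real \<times> real) list \<Rightarrow> real" where
  "span_inner K xs ys = (\<Sum>(s, a)\<leftarrow>xs. \<Sum>(u, b)\<leftarrow>ys. a * b * K s u)"

definition span_diff :: "(real \<times> real) list \<Rightarrow> (real \<times> real) list \<Rightarrow> (real \<times> real) list" where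
  "span_diff xs ys = xs @ map (\<lambda>(u, b). (u, - b)) ys"

text \<open>A sequence of span elements approximating f in the RKHS: Cauchy in the RKHS norm and
  converging pointwise to f (RKHS-norm convergence implies pointwise convergence).\<close>
definition rkhs_approx :: "(real \<Rightarrow> real \<Rightarrow> real) \<Rightarrow> (nat \<Rightarrow> (real \<times> real) list) \<Rightarrow> (real \<Rightarrow> real) \<Rightarrow> bool" where
  "rkhs_approx K g f \<longleftrightarrow>
     (\<forall>e>0. \<exists>N. \<forall>m\<ge>N. \<forall>n\<ge>N. span_inner K (span_diff (g m) (g n)) (span_diff (g m) (g n)) < e) \<and>
     (\<forall>t. (\<lambda>k. span_fun K (g k) t) \<longlonglongrightarrow> f t)"

definition rkhs :: "(real \<Rightarrow> real \<Rightarrow> real) \<Rightarrow> (real \<Rightarrow> real) set" where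
  "rkhs K = {f. \<exists>g. rkhs_approx K g f}"

text \<open>Squared RKHS norm: limit of the squared norms of any approximating sequence.\<close>
definition rkhs_norm_sq :: "(real \<Rightarrow> real \<Rightarrow> real) \<Rightarrow> (real \<Rightarrow> real) \<Rightarrow> real" where
  "rkhs_norm_sq K f = lim (\<lambda>k. span_inner K ((SOME g. rkhs_approx K g f) k) ((SOME g. rkhs_approx K g f) k))"

definition rateI :: "(real \<Rightarrow> real \<Rightarrow> real) \<Rightarrow> (real \<Rightarrow> real) \<Rightarrow> ereal" where
  "rateI K f = (if f \<in> rkhs K then ereal (rkhs_norm_sq K f / 2) else \<infinity>)"

text \<open>Q_{2,n}, with A(s,t) = A(t) - A(s).\<close>
definition Q2 :: "(nat \<Rightarrow> 'a \<Rightarrow> real \<Rightarrow> real) \<Rightarrow> real \<Rightarrow> real \<Rightarrow> nat \<Rightarrow> 'a \<Rightarrow> real" where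
  "Q2 A c1 c2 n \<omega> =
     (SUP t\<in>{0<..}. (\<Sum>i<n. A i \<omega> 0 - A i \<omega> (- t)) - real n * c2 * t)
   - (SUP s\<in>{0<..}. (\<Sum>i<n. A i \<omega> 0 - A i \<omega> (- s)) - real n * c1 * s)"

definition elog :: "real \<Rightarrow> ereal" where
  "elog p = (if p \<le> 0 then - \<infinity> else ereal (ln p))"

definition Uset :: "real \<Rightarrow> real \<Rightarrow> real \<Rightarrow> real \<Rightarrow> real \<Rightarrow> (real \<Rightarrow> real) set" where
  "Uset b c1 c2 s t = {f \<in> Omega. - f (- t) \<ge> b + c2 * t \<and> f (- s) - f (- t) \<ge> b + c2 * t - c1 * s}"

end

theory Submission
  imports Defs "HOL-Real_Asymp.Real_Asymp"
begin

text \<open>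
  Write \<open>x\<close> for the averaged path \<open>t \<mapsto> - (1/n) \<Sum> A\<^sub>i(-t)\<close>; it has the law of \<open>n\<^sup>-\<^sup>1\<^sup>/\<^sup>2 A\<close>. On the event
  \<open>Q\<^sub>2\<^sub>,\<^sub>n > n b\<close> there is a time \<open>t > t\<^sub>0 = b / (c\<^sub>1 - c\<^sub>2)\<close> with \<open>x(t) \<ge> b + c\<^sub>2 t\<close> and
  \<open>x(t) - x(s) \<ge> b + c\<^sub>2 t - c\<^sub>1 s\<close> for all \<open>s\<close>. For fixed \<open>s < t\<close>, Chernoff's bound with multipliers
  \<open>l, m \<ge> 0\<close> on the two constraints has as its best exponent the infimum of the rate function over
  \<open>U\<^sup>s\<^sup>,\<^sup>t\<close> (quadratic programming duality on the span of two kernel functions). The exponent with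
  \<open>s, l, m\<close> frozen is continuous in \<open>t\<close>, so compactness in \<open>t\<close> reduces the event to finitely many
  pairs, up to oscillations of the path over short time intervals and up to very large \<open>t\<close>. These two
  are superexponentially unlikely by Fernique's inequality, whose rotation argument applies to the
  independent copies \<open>A\<^sub>0, A\<^sub>1\<close> because the law of a process on path space is determined by the
  characteristic functions of its linear combinations.
\<close>

section \<open>Linear combinations of Gaussian processes\<close>

text \<open>For every n the path \<open>Z\<close> = sqrt n * x has exactly the law of A. The
  probability estimates are therefore stated for an arbitrary \<open>Z\<close> with the given
  covariance, with constants fixed from A_0 and A_1 before n is chosen; n enters only through
  thresholds proportional to sqrt n.

  Continuity of v alone gives no quantitative modulus of continuity of the paths. Fernique's
  inequality asks only for one level that is exceeded with probability at most 1/4, and path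
  continuity supplies it by a limiting argument. Shrinking the time window, or going far out in
  time, then pushes the exponent above any prescribed rate.

  Two obstacles shape the statements. Events quantified over real times may fail to be measurable,
  so they are bounded through measurable supersets. And a real-valued supremum carries information
  only for bounded sets, so \<open>Q2\<close> is taken apart only off the event of fast linear
  growth. The rate function enters through its values on finite kernel sums, because competitors in
  the constraint set are sought among combinations of two kernel functions.\<close>

definition lincomb :: "('i \<times> real) list \<Rightarrow> ('i \<Rightarrow> real) \<Rightarrow> real" where
  "lincomb cs x = (\<Sum>(t, c)\<leftarrow>cs. c * x t)"

lemma lincomb_Nil [simp]: "lincomb [] x = 0"
  and lincomb_Cons [simp]: "lincomb (p # cs) x = snd p * x (fst p) + lincomb cs x"
  and lincomb_append [simp]: "lincomb (cs @ ds) x = lincomb cs x + lincomb ds x"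
  by (auto simp: lincomb_def split: prod.splits)

lemma lincomb_add: "lincomb cs (\<lambda>t. x t + y t) = lincomb cs x + lincomb cs y"
  by (induction cs) (auto simp: algebra_simps)

lemma lincomb_mult: "lincomb cs (\<lambda>t. a * x t) = a * lincomb cs x"
  by (induction cs) (auto simp: algebra_simps)

lemma lincomb_sum: "lincomb cs (\<lambda>t. \<Sum>i\<in>I. x i t) = (\<Sum>i\<in>I. lincomb cs (x i))"
  by (induction cs) (auto simp: sum.distrib sum_distrib_left)

lemma lincomb_scale: "lincomb (map (\<lambda>(t, c). (t, a * c)) cs) x = a * lincomb cs x"
  by (induction cs) (auto simp: algebra_simps)

lemma lincomb_swap: "lincomb cs (\<lambda>s. lincomb ds (F s)) = lincomb ds (\<lambda>u. lincomb cs (\<lambda>s. F s u))"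
proof (induction cs)
  case Nil
  show ?case using lincomb_mult[of ds 0 "\<lambda>_. 0"] by simp
qed (simp add: lincomb_add lincomb_mult)

text \<open>Composition of linear functionals: the functional \<open>L t\<close> is substituted for
  the coordinate t, which pulls a functional of an image process back to the original
  process.\<close>

definition lincomb_bind :: "('i \<Rightarrow> ('j \<times> real) list) \<Rightarrow> ('i \<times> real) list \<Rightarrow> ('j \<times> real) list" where
  "lincomb_bind L cs = concat (map (\<lambda>(t, c). map (\<lambda>(u, d). (u, c * d)) (L t)) cs)"

lemma lincomb_bind: "lincomb (lincomb_bind L cs) x = lincomb cs (\<lambda>t. lincomb (L t) x)"
  by (induction cs) (auto simp: lincomb_bind_def lincomb_scale)

lemma lincomb_measurable:
  assumes "\<And>t. (\<lambda>\<omega>. X \<omega> t) \<in> borel_measurable M"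
  shows "(\<lambda>\<omega>. lincomb cs (X \<omega>)) \<in> borel_measurable M"
  by (induction cs) (auto intro!: borel_measurable_add borel_measurable_times assms)

lemma span_inner_lincomb: "span_inner K xs ys = lincomb xs (\<lambda>s. lincomb ys (K s))"
proof -
  have "(\<Sum>(u, b)\<leftarrow>ys. a * b * K s u) = a * lincomb ys (K s)" for a s
    by (induction ys) (auto simp: algebra_simps)
  then show ?thesis unfolding span_inner_def lincomb_def[of xs] by simp
qed

text \<open>The frequency u can be absorbed into the coefficients of the list, so characteristic
  functions at frequency 1, over all lists, carry the same information.\<close>

lemma centered_gaussian_process_iff:
  "centered_gaussian_process M X K \<longleftrightarrow>
    (\<forall>t. (\<lambda>\<omega>. X \<omega> t) \<in> borel_measurable M) \<and>
    (\<forall>cs. (CLINT \<omega>|M. iexp (lincomb cs (X \<omega>))) = of_real (exp (- span_inner K cs cs / 2)))"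
proof -
  have eq: "centered_gaussian_process M X K \<longleftrightarrow>
     (\<forall>cs. centered_gaussian_rv M (\<lambda>\<omega>. lincomb cs (X \<omega>)) (span_inner K cs cs))"
    by (simp add: centered_gaussian_process_def lincomb_def span_inner_def)
  show ?thesis
  proof (intro iffI conjI allI)
    fix t assume "centered_gaussian_process M X K"
    then have "centered_gaussian_rv M (\<lambda>\<omega>. lincomb [(t, 1)] (X \<omega>)) (span_inner K [(t, 1)] [(t, 1)])"
      unfolding eq by blast
    then show "(\<lambda>\<omega>. X \<omega> t) \<in> borel_measurable M"
      by (simp add: centered_gaussian_rv_def)
  next
    fix cs assume "centered_gaussian_process M X K"
    then have *: "centered_gaussian_rv M (\<lambda>\<omega>. lincomb cs (X \<omega>)) (span_inner K cs cs)"
      unfolding eq by blast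
    then have "char (distr M borel (\<lambda>\<omega>. lincomb cs (X \<omega>))) 1 = of_real (exp (- span_inner K cs cs / 2))"
      by (simp add: centered_gaussian_rv_def)
    with * show "(CLINT \<omega>|M. iexp (lincomb cs (X \<omega>))) = of_real (exp (- span_inner K cs cs / 2))"
      by (simp add: centered_gaussian_rv_def char_def integral_distr)
  next
    assume *: "(\<forall>t. (\<lambda>\<omega>. X \<omega> t) \<in> borel_measurable M) \<and>
      (\<forall>cs. (CLINT \<omega>|M. iexp (lincomb cs (X \<omega>))) = of_real (exp (- span_inner K cs cs / 2)))"
    have [measurable]: "(\<lambda>\<omega>. lincomb cs (X \<omega>)) \<in> borel_measurable M" for cs
      using * by (intro lincomb_measurable) auto
    have "char (distr M borel (\<lambda>\<omega>. lincomb cs (X \<omega>))) u = of_real (exp (- (u\<^sup>2 * span_inner K cs cs) / 2))"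
      for cs u
    proof -
      let ?ds = "map (\<lambda>(t, c). (t, u * c)) cs"
      have "char (distr M borel (\<lambda>\<omega>. lincomb cs (X \<omega>))) u = (CLINT \<omega>|M. iexp (lincomb ?ds (X \<omega>)))"
        by (simp add: char_def integral_distr lincomb_scale)
      also have "\<dots> = of_real (exp (- span_inner K ?ds ?ds / 2))"
        using * by blast
      also have "span_inner K ?ds ?ds = u\<^sup>2 * span_inner K cs cs"
        by (simp add: span_inner_lincomb lincomb_scale lincomb_mult power2_eq_square)
      finally show ?thesis .
    qed
    then show "centered_gaussian_process M X K"
      unfolding eq centered_gaussian_rv_def by simp
  qed
qed

lemma gaussian_lincomb_rv:
  "centered_gaussian_process M X K \<Longrightarrow>
    centered_gaussian_rv M (\<lambda>\<omega>. lincomb cs (X \<omega>)) (span_inner K cs cs)"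
  by (simp add: centered_gaussian_process_def lincomb_def span_inner_def)

lemma gaussian_process_measurable:
  "centered_gaussian_process M X K \<Longrightarrow> (\<lambda>\<omega>. X \<omega> t) \<in> borel_measurable M"
  by (simp add: centered_gaussian_process_iff)

text \<open>Covers time shifts, time reversal and normalisation at once: for each of them only a
  covariance identity remains to be computed.\<close>

lemma gaussian_process_linear_image:
  assumes "centered_gaussian_process M X K"
    and "\<And>t w. K' t w = span_inner K (L t) (L w)"
  shows "centered_gaussian_process M (\<lambda>\<omega> t. lincomb (L t) (X \<omega>)) K'"
  unfolding centered_gaussian_process_iff
proof (intro conjI allI)
  show "(\<lambda>\<omega>. lincomb (L t) (X \<omega>)) \<in> borel_measurable M" for t
    by (intro lincomb_measurable gaussian_process_measurable[OF assms(1)])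
  fix cs :: "(real \<times> real) list"
  have "span_inner K' cs cs = span_inner K (lincomb_bind L cs) (lincomb_bind L cs)"
    unfolding span_inner_lincomb lincomb_bind assms(2)
    by (subst (2) lincomb_swap) (rule refl)
  then show "(CLINT \<omega>|M. iexp (lincomb cs (\<lambda>t. lincomb (L t) (X \<omega>)))) = of_real (exp (- span_inner K' cs cs / 2))"
    using assms(1) by (simp add: centered_gaussian_process_iff flip: lincomb_bind)
qed

section \<open>Positivity of the covariance and one-dimensional tails\<close>

lemma gaussian_psd:
  assumes "prob_space M" "centered_gaussian_process M X K"
  shows "span_inner K cs cs \<ge> 0"
proof -
  interpret prob_space M by fact
  have [measurable]: "(\<lambda>\<omega>. lincomb cs (X \<omega>)) \<in> borel_measurable M"
    by (intro lincomb_measurable gaussian_process_measurable[OF assms(2)])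
  \<comment> \<open>A characteristic function has modulus at most 1, and
    \<open>exp (- V / 2) \<le> 1\<close> forces \<open>V \<ge> 0\<close>; positivity of the kernel
    is thus read off from the process.\<close>
  have "exp (- span_inner K cs cs / 2) = norm (CLINT \<omega>|M. iexp (lincomb cs (X \<omega>)))"
    using assms(2) by (simp add: centered_gaussian_process_iff)
  also have "\<dots> \<le> (LINT \<omega>|M. norm (iexp (lincomb cs (X \<omega>))))"
    by (rule integral_norm_bound)
  also have "\<dots> = 1" by (simp add: prob_space)
  finally show ?thesis by simp
qed

text \<open>Writing the law as an image of the standard normal, rather than by a density, includes
  the degenerate case \<open>\<sigma> = 0\<close>.\<close>

lemma centered_gaussian_rv_eq_normal:
  assumes "prob_space M" "centered_gaussian_rv M W (\<sigma>\<^sup>2)"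
  shows "distr M borel W = distr std_normal_distribution borel (\<lambda>z. \<sigma> * z)"
proof (rule Levy_uniqueness)
  interpret prob_space M by fact
  have [measurable]: "W \<in> borel_measurable M"
    using assms(2) by (simp add: centered_gaussian_rv_def)
  interpret N: real_distribution std_normal_distribution by (rule real_dist_normal_dist)
  show "real_distribution (distr M borel W)" by (rule real_distribution_distr) simp
  show "real_distribution (distr std_normal_distribution borel (\<lambda>z. \<sigma> * z))"
    by (rule N.real_distribution_distr) simp
  have "char (distr std_normal_distribution borel (\<lambda>z. \<sigma> * z)) u = char std_normal_distribution (u * \<sigma>)" for u
    unfolding char_def by (subst integral_distr) (simp_all add: mult.assoc)
  then show "char (distr M borel W) = char (distr std_normal_distribution borel (\<lambda>z. \<sigma> * z))"
    using assms(2) by (auto simp: centered_gaussian_rv_def char_std_normal_distribution power_mult_distrib)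
qed

text \<open>Completing the square: the exponential tilt by a turns the standard normal density into
  the one with mean a, up to the factor \<open>exp (a\<^sup>2 / 2)\<close>.\<close>

lemma normal_exponential_moment:
  "(\<integral>\<^sup>+z. ennreal (exp (a * z)) \<partial>std_normal_distribution) = ennreal (exp (a\<^sup>2 / 2))"
proof -
  interpret N: prob_space "density lborel (normal_density a 1)" by (rule prob_space_normal_density) simp
  have "exp (a * z) * std_normal_density z = exp (a\<^sup>2 / 2) * normal_density a 1 z" for z
  proof -
    have "a * z + - z\<^sup>2 / 2 = a\<^sup>2 / 2 + - (z - a)\<^sup>2 / 2"
      by (simp add: power2_eq_square field_simps)
    then have "exp (a * z) * exp (- z\<^sup>2 / 2) = exp (a\<^sup>2 / 2) * exp (- (z - a)\<^sup>2 / 2)"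
      unfolding exp_add[symmetric] by presburger
    then show ?thesis
      by (simp add: normal_density_def)
  qed
  then have "(\<integral>\<^sup>+z. ennreal (exp (a * z)) \<partial>std_normal_distribution)
      = (\<integral>\<^sup>+z. ennreal (exp (a\<^sup>2 / 2)) * ennreal (normal_density a 1 z) \<partial>lborel)"
    by (subst nn_integral_density) (auto simp: ennreal_mult[symmetric] mult.commute intro!: nn_integral_cong)
  also have "\<dots> = ennreal (exp (a\<^sup>2 / 2)) * (\<integral>\<^sup>+z. ennreal (normal_density a 1 z) \<partial>lborel)"
    by (rule nn_integral_cmult) simp
  also have "(\<integral>\<^sup>+z. ennreal (normal_density a 1 z) \<partial>lborel) = 1"
    using N.emeasure_space_1 by (simp add: emeasure_density)
  finally show ?thesis by simp
qed

text \<open>Markov's inequality for exp W, with the Chernoff parameter fixed at 1. Optimising over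
  the parameter is left to the caller, who can scale W.\<close>

lemma gaussian_tail:
  assumes "prob_space M" "centered_gaussian_rv M W V" "V \<ge> 0"
  shows "measure M {\<omega> \<in> space M. W \<omega> \<ge> w} \<le> exp (V / 2 - w)"
proof -
  interpret prob_space M by fact
  have [measurable]: "W \<in> borel_measurable M"
    using assms(2) by (simp add: centered_gaussian_rv_def)
  define \<sigma> where "\<sigma> = sqrt V"
  have V: "V = \<sigma>\<^sup>2" using assms(3) by (simp add: \<sigma>_def)
  have "emeasure M {\<omega> \<in> space M. W \<omega> \<ge> w} = (\<integral>\<^sup>+\<omega>. indicator {\<omega> \<in> space M. W \<omega> \<ge> w} \<omega> \<partial>M)"
    by simp
  also have "\<dots> \<le> (\<integral>\<^sup>+\<omega>. ennreal (exp (W \<omega> - w)) \<partial>M)"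
    by (intro nn_integral_mono) (auto simp: indicator_def)
  also have "\<dots> = (\<integral>\<^sup>+z. ennreal (exp (z - w)) \<partial>distr M borel W)"
    by (subst nn_integral_distr) auto
  also have "\<dots> = (\<integral>\<^sup>+z. ennreal (exp (\<sigma> * z - w)) \<partial>std_normal_distribution)"
    using assms(2) unfolding V
    by (subst centered_gaussian_rv_eq_normal[OF assms(1)]) (auto simp: nn_integral_distr)
  also have "\<dots> = (\<integral>\<^sup>+z. ennreal (exp (- w)) * ennreal (exp (\<sigma> * z)) \<partial>std_normal_distribution)"
    by (simp add: ennreal_mult[symmetric] exp_add[symmetric])
  also have "\<dots> = ennreal (exp (- w)) * ennreal (exp (\<sigma>\<^sup>2 / 2))"
    by (subst nn_integral_cmult) (auto simp: normal_exponential_moment)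
  also have "\<dots> = ennreal (exp (V / 2 - w))"
    by (simp add: V ennreal_mult[symmetric] exp_add[symmetric])
  finally show ?thesis
    by (simp add: emeasure_eq_measure)
qed

section \<open>Characteristic functions determine the law of a process\<close>

text \<open>A positive bounded weight, once normalised, is a density, and ordinary Levy uniqueness
  applies to the reweighted probability measures. The lower bound 1 keeps the normalising mass away
  from 0.\<close>

lemma weighted_Levy_uniqueness_nonneg:
  fixes f :: "'a \<Rightarrow> real" and g :: "'b \<Rightarrow> real"
  assumes "prob_space M" "prob_space N"
    and [measurable]: "f \<in> borel_measurable M" "X \<in> borel_measurable M"
    and [measurable]: "g \<in> borel_measurable N" "Y \<in> borel_measurable N"
    and f: "\<And>\<omega>. 1 \<le> f \<omega> \<and> f \<omega> \<le> 3" and g: "\<And>\<omega>. 1 \<le> g \<omega> \<and> g \<omega> \<le> 3"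
    and eq: "\<And>u. (CLINT \<omega>|M. of_real (f \<omega>) * iexp (u * X \<omega>)) = (CLINT \<omega>|N. of_real (g \<omega>) * iexp (u * Y \<omega>))"
    and B[measurable]: "B \<in> sets borel"
  shows "(LINT \<omega>|M. f \<omega> * indicator B (X \<omega>)) = (LINT \<omega>|N. g \<omega> * indicator B (Y \<omega>))"
proof -
  interpret M: prob_space M by fact
  interpret N: prob_space N by fact
  have intf: "integrable M f"
    using f by (intro M.integrable_const_bound[where B=3]) (auto simp: abs_le_iff intro!: always_eventually, smt (verit))
  have intg: "integrable N g"
    using g by (intro N.integrable_const_bound[where B=3]) (auto simp: abs_le_iff intro!: always_eventually, smt (verit))
  define c where "c = (LINT \<omega>|M. f \<omega>)"
  have "c \<ge> (LINT \<omega>|M. 1)" unfolding c_def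
    using f by (intro integral_mono intf) auto
  then have c1: "c \<ge> 1" by (simp add: M.prob_space)
  \<comment> \<open>Frequency 0 in the hypothesis says that both weights have the same total
    mass.\<close>
  have "complex_of_real c = of_real (LINT \<omega>|N. g \<omega>)"
    using eq[of 0] unfolding c_def by simp
  then have cg: "c = (LINT \<omega>|N. g \<omega>)" by (simp only: of_real_eq_iff)
  define P where "P = density M (\<lambda>\<omega>. ennreal (f \<omega> / c))"
  define Q where "Q = density N (\<lambda>\<omega>. ennreal (g \<omega> / c))"
  have fc: "0 \<le> f \<omega> / c" for \<omega> using f[of \<omega>] c1 by simp
  have gc: "0 \<le> g \<omega> / c" for \<omega> using g[of \<omega>] c1 by simp
  interpret P: prob_space P
  proof
    have "emeasure P (space P) = (\<integral>\<^sup>+\<omega>. ennreal (f \<omega> / c) \<partial>M)"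
      unfolding P_def by (simp add: emeasure_density cong: nn_integral_cong)
    also have "\<dots> = ennreal (LINT \<omega>|M. f \<omega> / c)"
      using fc intf by (intro nn_integral_eq_integral) auto
    finally show "emeasure P (space P) = 1" using c1 by (simp add: c_def)
  qed
  interpret Q: prob_space Q
  proof
    have "emeasure Q (space Q) = (\<integral>\<^sup>+\<omega>. ennreal (g \<omega> / c) \<partial>N)"
      unfolding Q_def by (simp add: emeasure_density cong: nn_integral_cong)
    also have "\<dots> = ennreal (LINT \<omega>|N. g \<omega> / c)"
      using gc intg by (intro nn_integral_eq_integral) auto
    finally show "emeasure Q (space Q) = 1" using c1 by (simp add: cg)
  qed
  have [measurable]: "X \<in> borel_measurable P" "Y \<in> borel_measurable Q"
    by (simp_all add: P_def Q_def)
  have "char (distr P borel X) u = (CLINT \<omega>|M. of_real (f \<omega>) * iexp (u * X \<omega>)) / of_real c" for u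
  proof -
    have "char (distr P borel X) u = (CLINT \<omega>|P. iexp (u * X \<omega>))"
      by (simp add: char_def integral_distr)
    also have "\<dots> = (CLINT \<omega>|M. (f \<omega> / c) *\<^sub>R iexp (u * X \<omega>))"
      unfolding P_def using fc by (subst integral_density) auto
    also have "\<dots> = (CLINT \<omega>|M. (of_real (f \<omega>) * iexp (u * X \<omega>)) / of_real c)"
      by (simp add: scaleR_conv_of_real)
    finally show ?thesis by simp
  qed
  moreover have "char (distr Q borel Y) u = (CLINT \<omega>|N. of_real (g \<omega>) * iexp (u * Y \<omega>)) / of_real c" for u
  proof -
    have "char (distr Q borel Y) u = (CLINT \<omega>|Q. iexp (u * Y \<omega>))"
      by (simp add: char_def integral_distr)
    also have "\<dots> = (CLINT \<omega>|N. (g \<omega> / c) *\<^sub>R iexp (u * Y \<omega>))"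
      unfolding Q_def using gc by (subst integral_density) auto
    also have "\<dots> = (CLINT \<omega>|N. (of_real (g \<omega>) * iexp (u * Y \<omega>)) / of_real c)"
      by (simp add: scaleR_conv_of_real)
    finally show ?thesis by simp
  qed
  ultimately have "char (distr P borel X) = char (distr Q borel Y)"
    using eq by auto
  then have "distr P borel X = distr Q borel Y"
    by (intro Levy_uniqueness P.real_distribution_distr Q.real_distribution_distr) auto
  then have "(LINT x|distr P borel X. indicator B x) = (LINT x|distr Q borel Y. indicator B x :: real)"
    by simp
  then have "(LINT \<omega>|P. indicator B (X \<omega>)) = (LINT \<omega>|Q. indicator B (Y \<omega>) :: real)"
    by (subst (asm) (1 2) integral_distr) auto
  then have "(LINT \<omega>|M. (f \<omega> / c) *\<^sub>R indicator B (X \<omega>)) = (LINT \<omega>|N. (g \<omega> / c) *\<^sub>R indicator B (Y \<omega>) :: real)"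
    unfolding P_def Q_def using fc gc by (subst (asm) (1 2) integral_density) auto
  then show ?thesis using c1 by simp
qed

text \<open>Adding 2 moves a signed weight into [1, 3]; by linearity the contribution of the
  constant weight 2 is subtracted again.\<close>

lemma weighted_Levy_uniqueness:
  fixes f :: "'a \<Rightarrow> real" and g :: "'b \<Rightarrow> real"
  assumes "prob_space M" "prob_space N"
    and [measurable]: "f \<in> borel_measurable M" "X \<in> borel_measurable M"
    and [measurable]: "g \<in> borel_measurable N" "Y \<in> borel_measurable N"
    and f: "\<And>\<omega>. \<bar>f \<omega>\<bar> \<le> 1" and g: "\<And>\<omega>. \<bar>g \<omega>\<bar> \<le> 1"
    and eq1: "\<And>u. (CLINT \<omega>|M. iexp (u * X \<omega>)) = (CLINT \<omega>|N. iexp (u * Y \<omega>))"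
    and eq: "\<And>u. (CLINT \<omega>|M. of_real (f \<omega>) * iexp (u * X \<omega>)) = (CLINT \<omega>|N. of_real (g \<omega>) * iexp (u * Y \<omega>))"
    and [measurable]: "B \<in> sets borel"
  shows "(LINT \<omega>|M. f \<omega> * indicator B (X \<omega>)) = (LINT \<omega>|N. g \<omega> * indicator B (Y \<omega>))"
proof -
  interpret M: prob_space M by fact
  interpret N: prob_space N by fact
  have intX: "integrable M (\<lambda>\<omega>. iexp (u * X \<omega>))" for u
    by (intro M.integrable_const_bound[where B=1]) auto
  have intY: "integrable N (\<lambda>\<omega>. iexp (u * Y \<omega>))" for u
    by (intro N.integrable_const_bound[where B=1]) auto
  have intfX: "integrable M (\<lambda>\<omega>. of_real (f \<omega>) * iexp (u * X \<omega>))" for u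
    using f by (intro M.integrable_const_bound[where B=1]) (auto simp: norm_mult)
  have intgY: "integrable N (\<lambda>\<omega>. of_real (g \<omega>) * iexp (u * Y \<omega>))" for u
    using g by (intro N.integrable_const_bound[where B=1]) (auto simp: norm_mult)
  have "1 \<le> 2 + f \<omega> \<and> 2 + f \<omega> \<le> 3" for \<omega> using f[of \<omega>] by linarith
  moreover have "1 \<le> 2 + g \<omega> \<and> 2 + g \<omega> \<le> 3" for \<omega> using g[of \<omega>] by linarith
  moreover have "(CLINT \<omega>|M. of_real (2 + f \<omega>) * iexp (u * X \<omega>)) = (CLINT \<omega>|N. of_real (2 + g \<omega>) * iexp (u * Y \<omega>))" for u
    using intX[of u] intY[of u] intfX[of u] intgY[of u] eq1[of u] eq[of u]
    by (simp add: distrib_right)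
  ultimately have 1: "(LINT \<omega>|M. (2 + f \<omega>) * indicator B (X \<omega>)) = (LINT \<omega>|N. (2 + g \<omega>) * indicator B (Y \<omega>))"
    by (intro weighted_Levy_uniqueness_nonneg[OF assms(1,2)]) auto
  have 2: "(LINT \<omega>|M. 2 * indicator B (X \<omega>)) = (LINT \<omega>|N. 2 * indicator B (Y \<omega>) :: real)"
    using eq1 by (intro weighted_Levy_uniqueness_nonneg[OF assms(1,2)]) auto
  have iX: "integrable M (\<lambda>\<omega>. indicator B (X \<omega>) :: real)"
    by (intro M.integrable_const_bound[where B=1]) auto
  have iY: "integrable N (\<lambda>\<omega>. indicator B (Y \<omega>) :: real)"
    by (intro N.integrable_const_bound[where B=1]) auto
  have ifX: "integrable M (\<lambda>\<omega>. f \<omega> * indicator B (X \<omega>) :: real)"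
    using f by (intro M.integrable_const_bound[where B=1]) (auto simp: abs_mult indicator_def)
  have igY: "integrable N (\<lambda>\<omega>. g \<omega> * indicator B (Y \<omega>) :: real)"
    using g by (intro N.integrable_const_bound[where B=1]) (auto simp: abs_mult indicator_def)
  show ?thesis using 1 2 iX iY ifX igY by (simp add: distrib_right)
qed

text \<open>Coordinates are converted from frequencies to indicators one at a time: the indicators
  already obtained, times the remaining exponential, form a weight, and one-dimensional weighted
  uniqueness handles coordinate j. The exponential factor stays in the statement so that the
  induction hypothesis can absorb u * x j into the list.\<close>

lemma iexp_indicator_eq:
  fixes X :: "'a \<Rightarrow> 'i \<Rightarrow> real" and Y :: "'b \<Rightarrow> 'i \<Rightarrow> real"
  assumes "prob_space M" "prob_space N"
    and X[measurable]: "\<And>t. (\<lambda>\<omega>. X \<omega> t) \<in> borel_measurable M"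
    and Y[measurable]: "\<And>t. (\<lambda>\<omega>. Y \<omega> t) \<in> borel_measurable N"
    and eq: "\<And>cs. (CLINT \<omega>|M. iexp (lincomb cs (X \<omega>))) = (CLINT \<omega>|N. iexp (lincomb cs (Y \<omega>)))"
    and "finite J" and "\<And>i. i \<in> J \<Longrightarrow> B i \<in> sets borel"
  shows "(CLINT \<omega>|M. of_real (\<Prod>i\<in>J. indicator (B i) (X \<omega> i)) * iexp (lincomb cs (X \<omega>))) =
         (CLINT \<omega>|N. of_real (\<Prod>i\<in>J. indicator (B i) (Y \<omega> i)) * iexp (lincomb cs (Y \<omega>)))"
  using assms(6,7)
proof (induction J arbitrary: cs rule: finite_induct)
  case empty
  then show ?case using eq by simp
next
  case (insert j J)
  interpret M: prob_space M by fact
  interpret N: prob_space N by fact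
  have [measurable]: "(\<lambda>\<omega>. lincomb cs (X \<omega>)) \<in> borel_measurable M"
    "(\<lambda>\<omega>. lincomb cs (Y \<omega>)) \<in> borel_measurable N" for cs
    by (auto intro!: lincomb_measurable)
  have [measurable]: "B i \<in> sets borel" if "i \<in> insert j J" for i
    using that insert.prems by blast
  define WX where "WX \<omega> = (\<Prod>i\<in>J. indicator (B i) (X \<omega> i) :: real)" for \<omega>
  define WY where "WY \<omega> = (\<Prod>i\<in>J. indicator (B i) (Y \<omega> i) :: real)" for \<omega>
  have mW[measurable]: "WX \<in> borel_measurable M" "WY \<in> borel_measurable N"
    unfolding WX_def WY_def by (auto intro!: borel_measurable_prod measurable_compose[OF X] measurable_compose[OF Y] borel_measurable_indicator)
  have WX: "0 \<le> WX \<omega>" "WX \<omega> \<le> 1" for \<omega>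
    unfolding WX_def by (auto intro!: prod_nonneg prod_le_1)
  have WY: "0 \<le> WY \<omega>" "WY \<omega> \<le> 1" for \<omega>
    unfolding WY_def by (auto intro!: prod_nonneg prod_le_1)
  have IH: "(CLINT \<omega>|M. of_real (WX \<omega>) * iexp (lincomb cs (X \<omega>))) = (CLINT \<omega>|N. of_real (WY \<omega>) * iexp (lincomb cs (Y \<omega>)))" for cs
    unfolding WX_def WY_def using insert by blast
  let ?n = "map (\<lambda>(t, c). (t, - c)) cs"
  have n: "lincomb ?n x = - lincomb cs x" for x
    using lincomb_scale[of "- 1" cs x] by simp
  have IM: "integrable M (\<lambda>\<omega>. of_real (WX \<omega>) * iexp (lincomb cs (X \<omega>)))" for cs
    using WX by (intro M.integrable_const_bound[where B=1]) (auto simp: norm_mult)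
  have IN: "integrable N (\<lambda>\<omega>. of_real (WY \<omega>) * iexp (lincomb cs (Y \<omega>)))" for cs
    using WY by (intro N.integrable_const_bound[where B=1]) (auto simp: norm_mult)
  have eq1: "(CLINT \<omega>|M. iexp (u * X \<omega> j)) = (CLINT \<omega>|N. iexp (u * Y \<omega> j))" for u
    using eq[of "[(j, u)]"] by simp
  have iexp_add: "iexp (x + l) = iexp x * (of_real (cos l) + \<i> * of_real (sin l))" for x l
    by (simp add: exp_add distrib_left exp_Euler cos_of_real sin_of_real)
  \<comment> \<open>Weights must be real, so the exponential is split into cosine and sine. Euler's
    formula turns each back into exponentials with exponents x + l and x - l, which are the
    induction hypothesis for \<open>cs\<close> and for its negation \<open>?n\<close>.\<close>
  have cosE: "complex_of_real (w * cos l) * iexp x = (of_real w * iexp (x + l) + of_real w * iexp (x + - l)) / 2" for w l x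
    unfolding iexp_add by (simp add: algebra_simps)
  have sinE: "complex_of_real (w * sin l) * iexp x = (of_real w * iexp (x + l) - of_real w * iexp (x + - l)) / (2 * \<i>)" for w l x
    unfolding iexp_add by (simp add: algebra_simps)
  have c: "(LINT \<omega>|M. (WX \<omega> * cos (lincomb cs (X \<omega>))) * indicator (B j) (X \<omega> j)) =
           (LINT \<omega>|N. (WY \<omega> * cos (lincomb cs (Y \<omega>))) * indicator (B j) (Y \<omega> j))"
  proof (rule weighted_Levy_uniqueness[OF assms(1,2) _ _ _ _ _ _ eq1])
    fix u
    show "(CLINT \<omega>|M. of_real (WX \<omega> * cos (lincomb cs (X \<omega>))) * iexp (u * X \<omega> j)) =
          (CLINT \<omega>|N. of_real (WY \<omega> * cos (lincomb cs (Y \<omega>))) * iexp (u * Y \<omega> j))"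
      unfolding cosE using IH[of "(j, u) # cs"] IH[of "(j, u) # ?n"] IM[of "(j, u) # cs"] IM[of "(j, u) # ?n"]
         IN[of "(j, u) # cs"] IN[of "(j, u) # ?n"]
      by (simp add: n del: of_real_add of_real_diff of_real_minus)
  qed (use WX WY in \<open>auto simp: abs_mult intro!: mult_le_one\<close>)
  have s: "(LINT \<omega>|M. (WX \<omega> * sin (lincomb cs (X \<omega>))) * indicator (B j) (X \<omega> j)) =
           (LINT \<omega>|N. (WY \<omega> * sin (lincomb cs (Y \<omega>))) * indicator (B j) (Y \<omega> j))"
  proof (rule weighted_Levy_uniqueness[OF assms(1,2) _ _ _ _ _ _ eq1])
    fix u
    show "(CLINT \<omega>|M. of_real (WX \<omega> * sin (lincomb cs (X \<omega>))) * iexp (u * X \<omega> j)) =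
          (CLINT \<omega>|N. of_real (WY \<omega> * sin (lincomb cs (Y \<omega>))) * iexp (u * Y \<omega> j))"
      unfolding sinE using IH[of "(j, u) # cs"] IH[of "(j, u) # ?n"] IM[of "(j, u) # cs"] IM[of "(j, u) # ?n"]
         IN[of "(j, u) # cs"] IN[of "(j, u) # ?n"]
      by (simp add: n del: of_real_add of_real_diff of_real_minus)
  qed (use WX WY in \<open>auto simp: abs_mult intro!: mult_le_one\<close>)
  have E: "complex_of_real (\<Prod>i\<in>insert j J. F i) * iexp l =
      of_real ((\<Prod>i\<in>J. F i) * cos l * F j) + \<i> * of_real ((\<Prod>i\<in>J. F i) * sin l * F j)" for F l
    using insert.hyps by (simp add: exp_Euler cos_of_real sin_of_real algebra_simps)
  have i: "integrable M (\<lambda>\<omega>. (WX \<omega> * cos (lincomb cs (X \<omega>))) * indicator (B j) (X \<omega> j))"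
     "integrable M (\<lambda>\<omega>. (WX \<omega> * sin (lincomb cs (X \<omega>))) * indicator (B j) (X \<omega> j))"
    using WX by (auto intro!: M.integrable_const_bound[where B=1] AE_I2 mult_le_one simp: abs_mult)
  have i': "integrable N (\<lambda>\<omega>. (WY \<omega> * cos (lincomb cs (Y \<omega>))) * indicator (B j) (Y \<omega> j))"
     "integrable N (\<lambda>\<omega>. (WY \<omega> * sin (lincomb cs (Y \<omega>))) * indicator (B j) (Y \<omega> j))"
    using WY by (auto intro!: N.integrable_const_bound[where B=1] AE_I2 mult_le_one simp: abs_mult)
  show ?case
    unfolding E WX_def[symmetric] WY_def[symmetric] using i i' c s
    by (simp del: of_real_mult)
qed

text \<open>Cylinder sets generate the product sigma-algebra, and the empty combination in
  \<open>iexp_indicator_eq\<close> leaves exactly the probability of a cylinder.\<close>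

theorem process_law_unique:
  fixes X :: "'a \<Rightarrow> 'i \<Rightarrow> real" and Y :: "'b \<Rightarrow> 'i \<Rightarrow> real"
  assumes "prob_space M" "prob_space N"
    and X: "\<And>t. (\<lambda>\<omega>. X \<omega> t) \<in> borel_measurable M"
    and Y: "\<And>t. (\<lambda>\<omega>. Y \<omega> t) \<in> borel_measurable N"
    and eq: "\<And>cs. (CLINT \<omega>|M. iexp (lincomb cs (X \<omega>))) = (CLINT \<omega>|N. iexp (lincomb cs (Y \<omega>)))"
  shows "distr M (PiM UNIV (\<lambda>_. borel)) X = distr N (PiM UNIV (\<lambda>_. borel)) Y"
proof -
  interpret M: prob_space M by fact
  interpret N: prob_space N by fact
  have mX[measurable]: "X \<in> measurable M (PiM UNIV (\<lambda>_. borel))"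
    using X by (intro measurable_PiM_single') auto
  have mY[measurable]: "Y \<in> measurable N (PiM UNIV (\<lambda>_. borel))"
    using Y by (intro measurable_PiM_single') auto
  interpret DX: prob_space "distr M (PiM UNIV (\<lambda>_. borel)) X" by (rule M.prob_space_distr) fact
   interpret DY: prob_space "distr N (PiM UNIV (\<lambda>_. borel)) Y" by (rule N.prob_space_distr) fact
  show ?thesis
  proof (rule measure_eqI_PiM_infinite)
    fix B and J :: "'i set" assume J: "finite J" and B: "\<And>i. i \<in> J \<Longrightarrow> B i \<in> sets (borel :: real measure)"
    let ?S = "prod_emb UNIV (\<lambda>_. borel) J (Pi\<^sub>E J B) :: ('i \<Rightarrow> real) set"
    have S[measurable]: "?S \<in> sets (PiM UNIV (\<lambda>_. borel))" using J B by (intro sets_PiM_I) auto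
    have S_iff: "indicator ?S x = (\<Prod>i\<in>J. indicator (B i) (x i) :: real)" for x
      using J by (auto simp: indicator_def prod_emb_def PiE_iff restrict_def extensional_def prod_zero_iff)
    have "complex_of_real (LINT \<omega>|M. indicator ?S (X \<omega>)) = of_real (LINT \<omega>|N. indicator ?S (Y \<omega>))"
      using iexp_indicator_eq[OF assms J B, where cs = "[]"] unfolding S_iff by (simp del: of_real_prod)
    then have "(LINT \<omega>|M. indicator ?S (X \<omega>)) = (LINT \<omega>|N. indicator ?S (Y \<omega>) :: real)"
      by (simp only: of_real_eq_iff)
    then have "(LINT x|distr M (PiM UNIV (\<lambda>_. borel)) X. indicator ?S x)
       = (LINT x|distr N (PiM UNIV (\<lambda>_. borel)) Y. indicator ?S x :: real)"
      by (subst (1 2) integral_distr) auto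
    then have "measure (distr M (PiM UNIV (\<lambda>_. borel)) X) ?S = measure (distr N (PiM UNIV (\<lambda>_. borel)) Y) ?S"
      by simp
    then show "emeasure (distr M (PiM UNIV (\<lambda>_. borel)) X) ?S = emeasure (distr N (PiM UNIV (\<lambda>_. borel)) Y) ?S"
      by (simp add: DX.emeasure_eq_measure DY.emeasure_eq_measure)
  qed (simp_all add: DX.finite_measure_axioms)
qed

section \<open>Fernique's inequality\<close>

abbreviation paths :: "('i \<Rightarrow> real) measure" where
  "paths \<equiv> PiM UNIV (\<lambda>_. borel)"

lemma gaussian_process_paths_measurable:
  "centered_gaussian_process M X K \<Longrightarrow> X \<in> measurable M paths"
  by (intro measurable_PiM_single') (auto intro: gaussian_process_measurable)

lemma gaussian_law_unique:
  assumes "prob_space M" "prob_space N"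
    and X: "centered_gaussian_process M X K" and Y: "centered_gaussian_process N Y K"
    and S: "S \<in> sets paths"
  shows "measure M {\<omega> \<in> space M. X \<omega> \<in> S} = measure N {\<omega> \<in> space N. Y \<omega> \<in> S}"
proof -
  have "distr M paths X = distr N paths Y"
    using X Y by (intro process_law_unique assms(1,2)) (auto simp: centered_gaussian_process_iff)
  then have "measure (distr M paths X) S = measure (distr N paths Y) S" by simp
  then show ?thesis
    using gaussian_process_paths_measurable[OF X] gaussian_process_paths_measurable[OF Y] S
    by (simp add: measure_distr vimage_def Int_def conj_commute)
qed

text \<open>The right-hand side sees a and b only through the inner products of the plane vectors (a
  i, b i); rotating all of these vectors leaves it unchanged.\<close>

lemma iexp_lincomb_indep_pair:
  fixes a b :: "bool \<Rightarrow> real"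
  assumes "prob_space M"
    and X: "centered_gaussian_process M X K" and Y: "centered_gaussian_process M Y K"
    and indep: "prob_space.indep_var M paths X paths Y"
  shows "(CLINT \<omega>|M. iexp (lincomb cs (\<lambda>(i, t). a i * X \<omega> t + b i * Y \<omega> t))) =
    of_real (exp (- lincomb cs (\<lambda>(i, s). lincomb cs (\<lambda>(j, t). (a i * a j + b i * b j) * K s t)) / 2))"
proof -
  interpret prob_space M by fact
  define ds where "ds f = map (\<lambda>((i, t), c). (t :: real, f i * c)) cs" for f :: "bool \<Rightarrow> real"
  have ds: "lincomb (ds f) x = lincomb cs (\<lambda>(i, t). f i * x t)" for f x
    unfolding ds_def by (induction cs) auto
  have split: "lincomb cs (\<lambda>(i, t). a i * x t + b i * y t) = lincomb (ds a) x + lincomb (ds b) y" for x y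
    unfolding ds lincomb_add[symmetric] by (simp add: case_prod_unfold)
  have inner: "span_inner K (ds f) (ds f) = lincomb cs (\<lambda>(i, s). lincomb cs (\<lambda>(j, t). (f i * f j) * K s t))" for f
    unfolding span_inner_lincomb ds case_prod_unfold by (simp add: lincomb_mult mult.assoc)
  have lin[measurable]: "lincomb cs \<in> borel_measurable paths" for cs :: "(real \<times> real) list"
    by (rule lincomb_measurable) simp
  have "indep_var borel (\<lambda>\<omega>. iexp (lincomb (ds a) (X \<omega>))) borel (\<lambda>\<omega>. iexp (lincomb (ds b) (Y \<omega>)))"
    using indep_var_compose[OF indep, of "\<lambda>x. iexp (lincomb (ds a) x)" borel "\<lambda>x. iexp (lincomb (ds b) x)" borel]
    by (simp add: comp_def)
  then have "(CLINT \<omega>|M. iexp (lincomb (ds a) (X \<omega>)) * iexp (lincomb (ds b) (Y \<omega>))) =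
    (CLINT \<omega>|M. iexp (lincomb (ds a) (X \<omega>))) * (CLINT \<omega>|M. iexp (lincomb (ds b) (Y \<omega>)))"
    using gaussian_process_paths_measurable[OF X] gaussian_process_paths_measurable[OF Y]
    by (intro indep_var_lebesgue_integral) (auto intro!: integrable_const_bound[where B=1])
  also have "\<dots> = of_real (exp (- span_inner K (ds a) (ds a) / 2)) * of_real (exp (- span_inner K (ds b) (ds b) / 2))"
    using X Y by (simp add: centered_gaussian_process_iff)
  also have "\<dots> = of_real (exp (- (span_inner K (ds a) (ds a) + span_inner K (ds b) (ds b)) / 2))"
    by (simp add: of_real_mult[symmetric] exp_add[symmetric] add_divide_distrib del: of_real_mult of_real_exp)
  also have "span_inner K (ds a) (ds a) + span_inner K (ds b) (ds b)
     = lincomb cs (\<lambda>(i, s). lincomb cs (\<lambda>(j, t). (a i * a j + b i * b j) * K s t))"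
    unfolding inner case_prod_unfold by (simp add: distrib_right lincomb_add)
  finally show ?thesis
    unfolding split by (simp add: exp_add distrib_left)
qed

text \<open>Indexing by \<open>bool \<times> real\<close> packs the pair of processes into a single
  one, so that uniqueness of process laws yields equality of joint laws.\<close>

lemma gaussian_rotation:
  assumes "prob_space M"
    and X: "centered_gaussian_process M X K" and Y: "centered_gaussian_process M Y K"
    and indep: "prob_space.indep_var M paths X paths Y"
    and [measurable]: "E \<in> sets paths" "F \<in> sets paths"
  shows "measure M {\<omega> \<in> space M. X \<omega> \<in> E \<and> Y \<omega> \<in> F} =
    measure M {\<omega> \<in> space M. (\<lambda>t. (X \<omega> t - Y \<omega> t) / sqrt 2) \<in> E \<and> (\<lambda>t. (X \<omega> t + Y \<omega> t) / sqrt 2) \<in> F}"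
proof -
  define Z where "Z a b \<omega> = (\<lambda>(i, t). a i * X \<omega> t + b i * Y \<omega> t)" for a b :: "bool \<Rightarrow> real" and \<omega>
  \<comment> \<open>The first pair of coefficients gives (X, Y) itself, the second the pair ((X - Y)
    / sqrt 2, (X + Y) / sqrt 2); both have the identity as Gram matrix.\<close>
  define a1 b1 a2 b2 :: "bool \<Rightarrow> real" where
    "a1 i = (if i then 1 else 0)" and "b1 i = (if i then 0 else 1)" and
    "a2 i = 1 / sqrt 2" and "b2 i = (if i then - 1 / sqrt 2 else 1 / sqrt 2)" for i
  have m: "(\<lambda>\<omega>. Z a b \<omega> p) \<in> borel_measurable M" for a b p
    unfolding Z_def case_prod_unfold
    by (intro borel_measurable_add borel_measurable_times borel_measurable_const
        gaussian_process_measurable[OF X] gaussian_process_measurable[OF Y])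
  have mZ: "Z a b \<in> measurable M paths" for a b
    using m by (intro measurable_PiM_single') auto
  have eq: "a1 i * a1 j + b1 i * b1 j = a2 i * a2 j + b2 i * b2 j" for i j
    by (auto simp: a1_def a2_def b1_def b2_def)
  have law: "distr M paths (Z a1 b1) = distr M paths (Z a2 b2)"
  proof (rule process_law_unique[OF assms(1,1) m m])
    show "(CLINT \<omega>|M. iexp (lincomb cs (Z a1 b1 \<omega>))) = (CLINT \<omega>|M. iexp (lincomb cs (Z a2 b2 \<omega>)))" for cs
      unfolding Z_def iexp_lincomb_indep_pair[OF assms(1) X Y indep] eq ..
  qed
  define S where "S = {z \<in> space paths. (\<lambda>t. z (True, t)) \<in> E \<and> (\<lambda>t. z (False, t)) \<in> F}"
  have [measurable]: "(\<lambda>z t. z (i, t)) \<in> measurable (paths :: (bool \<times> real \<Rightarrow> real) measure) paths" for i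
    by (intro measurable_PiM_single') auto
  have S: "S \<in> sets paths"
    unfolding S_def by measurable
  have "measure (distr M paths (Z a1 b1)) S = measure (distr M paths (Z a2 b2)) S"
    unfolding law ..
  then have "measure M {\<omega> \<in> space M. Z a1 b1 \<omega> \<in> S} = measure M {\<omega> \<in> space M. Z a2 b2 \<omega> \<in> S}"
    using mZ S by (simp add: measure_distr vimage_def Int_def conj_commute)
  moreover have "Z a1 b1 \<omega> \<in> S \<longleftrightarrow> X \<omega> \<in> E \<and> Y \<omega> \<in> F" for \<omega>
    by (simp add: S_def Z_def a1_def b1_def space_PiM)
  moreover have "(\<lambda>t. Z a2 b2 \<omega> (True, t)) = (\<lambda>t. (X \<omega> t - Y \<omega> t) / sqrt 2)"
    "(\<lambda>t. Z a2 b2 \<omega> (False, t)) = (\<lambda>t. (X \<omega> t + Y \<omega> t) / sqrt 2)" for \<omega>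
    by (auto simp: Z_def a2_def b2_def diff_divide_distrib add_divide_distrib)
  then have "Z a2 b2 \<omega> \<in> S \<longleftrightarrow> (\<lambda>t. (X \<omega> t - Y \<omega> t) / sqrt 2) \<in> E \<and> (\<lambda>t. (X \<omega> t + Y \<omega> t) / sqrt 2) \<in> F" for \<omega>
    unfolding S_def by (simp add: space_PiM)
  ultimately show ?thesis by simp
qed

text \<open>The complement of a ball for the seminorm sup over J of |x u - x w|. The product
  sigma-algebra sees only countably many coordinates, which is why J will always be
  countable.\<close>

definition osc_exceeds :: "('i \<times> 'i) set \<Rightarrow> real \<Rightarrow> ('i \<Rightarrow> real) set" where
  "osc_exceeds J r = {x. \<exists>(u, w)\<in>J. \<bar>x u - x w\<bar> > r}"

lemma osc_exceeds_sets [measurable]: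
  assumes "countable J"
  shows "osc_exceeds J r \<in> sets paths"
proof -
  have "osc_exceeds J r = {x \<in> space paths. \<exists>p\<in>J. \<bar>x (fst p) - x (snd p)\<bar> > r}"
    by (auto simp: osc_exceeds_def space_PiM case_prod_unfold)
  also have "\<dots> \<in> sets paths"
    using assms by measurable
  finally show ?thesis .
qed

text \<open>The left side is the probability that X has oscillation at most s while its copy Y
  exceeds r. After the rotation, X - Y is small everywhere and X + Y is large at some pair (u, w),
  and at that same pair both X and Y must be large.\<close>

lemma fernique_step:
  fixes X Y :: "'a \<Rightarrow> real \<Rightarrow> real"
  assumes "prob_space M"
    and X: "centered_gaussian_process M X K" and Y: "centered_gaussian_process M Y K"
    and indep: "prob_space.indep_var M paths X paths Y"
    and J: "countable J"
  defines "q \<equiv> \<lambda>r. measure M {\<omega> \<in> space M. X \<omega> \<in> osc_exceeds J r}"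
  shows "(1 - q s) * q r \<le> (q ((r - s) / sqrt 2))\<^sup>2"
proof -
  interpret prob_space M by fact
  note mX[measurable] = gaussian_process_paths_measurable[OF X]
  note mY[measurable] = gaussian_process_paths_measurable[OF Y]
  have O[measurable]: "osc_exceeds J r \<in> sets paths" for r using osc_exceeds_sets[OF J] .
  have prod: "measure M {\<omega> \<in> space M. X \<omega> \<in> E \<and> Y \<omega> \<in> F} =
      measure M {\<omega> \<in> space M. X \<omega> \<in> E} * measure M {\<omega> \<in> space M. X \<omega> \<in> F}"
    if EF: "E \<in> sets paths" "F \<in> sets paths" for E F
  proof -
    have "measure M {\<omega> \<in> space M. X \<omega> \<in> E \<and> Y \<omega> \<in> F} = measure M {\<omega> \<in> space M. X \<omega> \<in> E} * measure M {\<omega> \<in> space M. Y \<omega> \<in> F}"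
      using indep_varD[OF indep EF] by (simp add: vimage_def Int_def conj_commute)
    also have "measure M {\<omega> \<in> space M. Y \<omega> \<in> F} = measure M {\<omega> \<in> space M. X \<omega> \<in> F}"
      by (rule gaussian_law_unique[OF assms(1,1) Y X EF(2)])
    finally show ?thesis .
  qed
  have compl: "space paths - osc_exceeds J s \<in> sets paths" by measurable
  have "measure M {\<omega> \<in> space M. X \<omega> \<in> space paths - osc_exceeds J s} = 1 - q s"
  proof -
    have "{\<omega> \<in> space M. X \<omega> \<in> space paths - osc_exceeds J s} = space M - {\<omega> \<in> space M. X \<omega> \<in> osc_exceeds J s}"
      by (auto simp: space_PiM)
    then show ?thesis unfolding q_def by (simp add: prob_compl)
  qed
  then have "(1 - q s) * q r = measure M {\<omega> \<in> space M. X \<omega> \<in> space paths - osc_exceeds J s \<and> Y \<omega> \<in> osc_exceeds J r}"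
    unfolding q_def using prod[OF compl O] by simp
  also have "\<dots> = measure M {\<omega> \<in> space M. (\<lambda>t. (X \<omega> t - Y \<omega> t) / sqrt 2) \<in> space paths - osc_exceeds J s \<and>
      (\<lambda>t. (X \<omega> t + Y \<omega> t) / sqrt 2) \<in> osc_exceeds J r}"
    by (rule gaussian_rotation[OF assms(1) X Y indep compl O])
  also have "\<dots> \<le> measure M {\<omega> \<in> space M. X \<omega> \<in> osc_exceeds J ((r - s) / sqrt 2) \<and> Y \<omega> \<in> osc_exceeds J ((r - s) / sqrt 2)}"
  proof (rule finite_measure_mono)
    show "{\<omega> \<in> space M. (\<lambda>t. (X \<omega> t - Y \<omega> t) / sqrt 2) \<in> space paths - osc_exceeds J s \<and>
      (\<lambda>t. (X \<omega> t + Y \<omega> t) / sqrt 2) \<in> osc_exceeds J r}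
      \<subseteq> {\<omega> \<in> space M. X \<omega> \<in> osc_exceeds J ((r - s) / sqrt 2) \<and> Y \<omega> \<in> osc_exceeds J ((r - s) / sqrt 2)}"
    proof safe
      fix \<omega>
      assume "(\<lambda>t. (X \<omega> t - Y \<omega> t) / sqrt 2) \<notin> osc_exceeds J s"
        and "(\<lambda>t. (X \<omega> t + Y \<omega> t) / sqrt 2) \<in> osc_exceeds J r"
      then obtain u w where uw: "(u, w) \<in> J"
        and 1: "\<bar>(X \<omega> u + Y \<omega> u) / sqrt 2 - (X \<omega> w + Y \<omega> w) / sqrt 2\<bar> > r"
        and 2: "\<bar>(X \<omega> u - Y \<omega> u) / sqrt 2 - (X \<omega> w - Y \<omega> w) / sqrt 2\<bar> \<le> s"
        unfolding osc_exceeds_def by force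
      define \<xi> \<eta> where "\<xi> = X \<omega> u - X \<omega> w" and "\<eta> = Y \<omega> u - Y \<omega> w"
      have 1: "\<bar>\<xi> + \<eta>\<bar> / sqrt 2 > r"
        using 1 by (simp add: \<xi>_def \<eta>_def diff_divide_distrib[symmetric] algebra_simps)
      have 2: "\<bar>\<xi> - \<eta>\<bar> / sqrt 2 \<le> s"
        using 2 by (simp add: \<xi>_def \<eta>_def diff_divide_distrib[symmetric] algebra_simps)
      have 3: "r - s < (\<bar>\<xi> + \<eta>\<bar> - \<bar>\<xi> - \<eta>\<bar>) / sqrt 2"
        using 1 2 by (simp add: diff_divide_distrib)
      then have "(r - s) / sqrt 2 < (\<bar>\<xi> + \<eta>\<bar> - \<bar>\<xi> - \<eta>\<bar>) / sqrt 2 / sqrt 2"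
        by (rule divide_strict_right_mono) simp
      then have 4: "(r - s) / sqrt 2 < (\<bar>\<xi> + \<eta>\<bar> - \<bar>\<xi> - \<eta>\<bar>) / 2"
        by simp
      \<comment> \<open>|\<xi> + \<eta>| - |\<xi> - \<eta>| is twice the smaller of |\<xi>| and
        |\<eta>| up to sign, so one lower bound serves both increments.\<close>
      have 5: "\<bar>\<xi> + \<eta>\<bar> - \<bar>\<xi> - \<eta>\<bar> \<le> 2 * \<bar>\<xi>\<bar>" by linarith
      have 6: "\<bar>\<xi> + \<eta>\<bar> - \<bar>\<xi> - \<eta>\<bar> \<le> 2 * \<bar>\<eta>\<bar>" by linarith
      have "(r - s) / sqrt 2 < \<bar>\<xi>\<bar>" using 5 by (intro order.strict_trans2[OF 4]) simp
      moreover have "(r - s) / sqrt 2 < \<bar>\<eta>\<bar>" using 6 by (intro order.strict_trans2[OF 4]) simp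
      ultimately show "X \<omega> \<in> osc_exceeds J ((r - s) / sqrt 2)" "Y \<omega> \<in> osc_exceeds J ((r - s) / sqrt 2)"
        using uw by (auto simp: osc_exceeds_def \<xi>_def \<eta>_def)
    qed
  qed simp
  also have "\<dots> = (q ((r - s) / sqrt 2))\<^sup>2"
    unfolding q_def by (subst prod) (auto simp: power2_eq_square)
  finally show ?thesis .
qed

text \<open>Each use of \<open>fernique_step\<close> squares the probability while the radius grows
  only by a factor of about sqrt 2, which gives Gaussian decay. The threshold 1/4 makes 4/3 times
  the probability start at 1/3, a number below exp (- 1).\<close>

theorem fernique:
  fixes X Y :: "'a \<Rightarrow> real \<Rightarrow> real"
  assumes "prob_space M"
    and X: "centered_gaussian_process M X K" and Y: "centered_gaussian_process M Y K"
    and indep: "prob_space.indep_var M paths X paths Y"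
    and J: "countable J" and s: "s > 0" and r: "r \<ge> 4 * s"
    and small: "measure M {\<omega> \<in> space M. X \<omega> \<in> osc_exceeds J s} \<le> 1 / 4"
  shows "measure M {\<omega> \<in> space M. X \<omega> \<in> osc_exceeds J r} \<le> exp (- r\<^sup>2 / (32 * s\<^sup>2))"
proof -
  interpret prob_space M by fact
  define q where "q r = measure M {\<omega> \<in> space M. X \<omega> \<in> osc_exceeds J r}" for r
  note step = fernique_step[OF assms(1) X Y indep J, folded q_def]
  have O[measurable]: "osc_exceeds J r \<in> sets paths" for r using osc_exceeds_sets[OF J] .
  note mX[measurable] = gaussian_process_paths_measurable[OF X]
  have q0: "0 \<le> q r" for r by (simp add: q_def)
  have qmono: "q r' \<le> q r" if "r \<le> r'" for r r'
    unfolding q_def using that by (intro finite_measure_mono; measurable) (force simp: osc_exceeds_def)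
  \<comment> \<open>The recursion inverts the map from r to (r - s) / sqrt 2 in
    \<open>fernique_step\<close>. Its growth is estimated below by 4 s sqrt 2 ^ n - 3 s, whence the
    requirement \<open>r \<ge> 4 * s\<close>.\<close>
  define \<rho> where "\<rho> = rec_nat s (\<lambda>_ y. s + sqrt 2 * y)"
  have \<rho>0: "\<rho> 0 = s" and \<rho>S: "\<rho> (Suc n) = s + sqrt 2 * \<rho> n" for n
    by (simp_all add: \<rho>_def)
  have iter: "4 / 3 * q (\<rho> n) \<le> (1 / 3) ^ (2 ^ n)" for n
  proof (induction n)
    case 0
    show ?case using small by (simp add: \<rho>0 q_def)
  next
    case (Suc n)
    have "3 / 4 * q (\<rho> (Suc n)) \<le> (1 - q s) * q (\<rho> (Suc n))"
      using small q0 by (intro mult_right_mono) (auto simp: q_def)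
    also have "\<dots> \<le> (q (\<rho> n))\<^sup>2"
      using step[of s "\<rho> (Suc n)"] by (simp add: \<rho>S)
    finally have "4 / 3 * q (\<rho> (Suc n)) \<le> (4 / 3 * q (\<rho> n))\<^sup>2"
      by (simp add: power2_eq_square)
    also have "\<dots> \<le> ((1 / 3) ^ (2 ^ n))\<^sup>2"
      using Suc q0 by (intro power_mono) auto
    finally show ?case by (simp add: power_mult[symmetric] mult.commute)
  qed
  have \<rho>le: "\<rho> n \<le> 4 * s * sqrt 2 ^ n - 3 * s" for n
  proof (induction n)
    case (Suc n)
    have "sqrt 2 \<ge> 4 / 3" by (rule real_le_rsqrt) (simp add: power2_eq_square)
    then have "s * (4 / 3) \<le> s * sqrt 2" using s by (intro mult_left_mono) auto
    moreover have "sqrt 2 * \<rho> n \<le> sqrt 2 * (4 * s * sqrt 2 ^ n - 3 * s)"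
      using Suc by (intro mult_left_mono) auto
    ultimately show ?case by (simp add: \<rho>S algebra_simps)
  qed (simp add: \<rho>0)
  define y where "y = r / (4 * s)"
  have y1: "y \<ge> 1" using s r by (simp add: y_def field_simps)
  \<comment> \<open>The largest n with 2 ^ n at most (r / (4 s))^2, so that the radius
    \<open>\<rho> n\<close> stays below r. By maximality 2 ^ n exceeds half of this square, which is
    the 32 in the exponent.\<close>
  define n where "n = nat \<lfloor>log 2 (y\<^sup>2)\<rfloor>"
  have l0: "log 2 (y\<^sup>2) \<ge> 0" using y1 by (simp add: one_le_power)
  have n1: "real n \<le> log 2 (y\<^sup>2)" and n2: "log 2 (y\<^sup>2) < real n + 1"
    unfolding n_def using l0 by linarith+
  have y2: "y\<^sup>2 > 0" using y1 by auto
  have "2 powr real n \<le> y\<^sup>2"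
    using n1 y2 by (simp add: le_log_iff)
  then have p1: "2 ^ n \<le> y\<^sup>2" by (simp add: powr_realpow)
  have "y\<^sup>2 < 2 powr (real n + 1)"
    using n2 y2 by (simp add: log_less_iff)
  then have p2: "y\<^sup>2 < 2 * 2 ^ n" by (simp add: powr_realpow powr_add)
  have "sqrt 2 ^ n = sqrt (2 ^ n)" by (simp add: real_sqrt_power)
  also have "\<dots> \<le> y" using p1 y1 by (intro real_le_lsqrt) auto
  finally have "4 * s * sqrt 2 ^ n \<le> 4 * s * y" using s by (intro mult_left_mono) auto
  then have "\<rho> n \<le> r" using \<rho>le[of n] s by (simp add: y_def)
  then have "q r \<le> q (\<rho> n)" by (rule qmono)
  also have "\<dots> \<le> 4 / 3 * q (\<rho> n)" using q0[of "\<rho> n"] by simp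
  also have "\<dots> \<le> (1 / 3) ^ (2 ^ n)" by (rule iter)
  also have "\<dots> \<le> exp (- 1) ^ (2 ^ n)"
    using exp_le by (intro power_mono) (auto simp: exp_minus field_simps)
  also have "\<dots> = exp (- (2 ^ n))"
    by (simp add: exp_of_nat_mult[symmetric])
  also have "\<dots> \<le> exp (- (r\<^sup>2 / (32 * s\<^sup>2)))"
    using p2 s by (simp add: y_def power_divide power_mult_distrib field_simps)
  finally show ?thesis unfolding q_def by simp
qed

section \<open>Oscillations of continuous Gaussian paths\<close>

text \<open>Tail and crossing events quantify over real times and need not lie in the sigma-algebra.
  Finite unions and monotonicity still work for outer bounds, and in the end only the covering set
  has to be measurable.\<close>

definition outer_le :: "'a measure \<Rightarrow> 'a set \<Rightarrow> real \<Rightarrow> bool" where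
  "outer_le M S p \<longleftrightarrow> (\<exists>G\<in>sets M. S \<subseteq> G \<and> measure M G \<le> p)"

lemma outer_leI: "G \<in> sets M \<Longrightarrow> S \<subseteq> G \<Longrightarrow> measure M G \<le> p \<Longrightarrow> outer_le M S p"
  by (auto simp: outer_le_def)

lemma outer_le_mono: "outer_le M S p \<Longrightarrow> T \<subseteq> S \<Longrightarrow> p \<le> p' \<Longrightarrow> outer_le M T p'"
  unfolding outer_le_def by (meson order_trans)

lemma outer_le_Un:
  assumes "outer_le M S p" "outer_le M T r"
  shows "outer_le M (S \<union> T) (p + r)"
proof -
  obtain G H where "G \<in> sets M" "S \<subseteq> G" "measure M G \<le> p" "H \<in> sets M" "T \<subseteq> H" "measure M H \<le> r"
    using assms by (auto simp: outer_le_def)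
  then show ?thesis
    using measure_Un_le[of G M H] by (intro outer_leI[of "G \<union> H"]) auto
qed

lemma outer_le_UN:
  assumes "finite I" "\<And>i. i \<in> I \<Longrightarrow> outer_le M (S i) p"
  shows "outer_le M (\<Union>i\<in>I. S i) (real (card I) * p)"
  using assms
proof (induction I rule: finite_induct)
  case empty
  show ?case by (rule outer_leI[of "{}"]) auto
next
  case (insert i I)
  then have "outer_le M (S i \<union> (\<Union>i\<in>I. S i)) (p + real (card I) * p)"
    by (intro outer_le_Un) auto
  then show ?case using insert by (simp add: algebra_simps)
qed

lemma measure_le_outer:
  assumes "prob_space M" "outer_le M S p"
  shows "measure M S \<le> p"
proof -
  interpret prob_space M by fact
  obtain G where G: "G \<in> sets M" "S \<subseteq> G" "measure M G \<le> p" using assms(2) by (auto simp: outer_le_def)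
  have "measure M S \<le> measure M G" using G by (intro finite_measure_mono) auto
  with G show ?thesis by simp
qed

text \<open>In terms of x = Z / sqrt n the event reads \<open>lincomb cs x \<ge> w\<close>; scaling
  the coefficients by sqrt n in \<open>gaussian_tail\<close> produces the factor n in the
  exponent.\<close>

lemma chernoff:
  assumes "prob_space M" "centered_gaussian_process M Z K"
  shows "measure M {\<omega> \<in> space M. lincomb cs (Z \<omega>) \<ge> sqrt (real n) * w}
    \<le> exp (real n * (span_inner K cs cs / 2 - w))"
proof (cases "n = 0")
  case True
  interpret prob_space M by fact
  from True show ?thesis by simp
next
  case False
  let ?ds = "map (\<lambda>(t, c). (t, sqrt (real n) * c)) cs"
  have "measure M {\<omega> \<in> space M. lincomb ?ds (Z \<omega>) \<ge> real n * w}
    \<le> exp (span_inner K ?ds ?ds / 2 - real n * w)"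
    by (intro gaussian_tail gaussian_lincomb_rv gaussian_psd[OF assms] assms)
  moreover have "lincomb ?ds x \<ge> real n * w \<longleftrightarrow> lincomb cs x \<ge> sqrt (real n) * w" for x
  proof -
    have "lincomb ?ds x \<ge> real n * w \<longleftrightarrow> sqrt (real n) * lincomb cs x \<ge> sqrt (real n) * (sqrt (real n) * w)"
      by (simp add: lincomb_scale mult.assoc[symmetric])
    then show ?thesis using False by simp
  qed
  moreover have "span_inner K ?ds ?ds = real n * span_inner K cs cs"
    by (simp add: span_inner_lincomb lincomb_scale lincomb_mult mult.assoc[symmetric])
  ultimately show ?thesis by (simp add: algebra_simps)
qed

section \<open>Path oscillations over rational pairs of times\<close>

definition rat_pairs :: "real \<Rightarrow> real \<Rightarrow> (real \<times> real) set" where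
  "rat_pairs R \<delta> = {(u, w). u \<in> \<rat> \<and> w \<in> \<rat> \<and> \<bar>u\<bar> < R \<and> \<bar>w\<bar> < R \<and> \<bar>u - w\<bar> < \<delta>}"

lemma countable_rat_pairs: "countable (rat_pairs R \<delta>)"
  by (rule countable_subset[of _ "\<rat> \<times> \<rat>"]) (auto simp: rat_pairs_def countable_rat)

lemma open_contains_rat:
  fixes S :: "real set"
  assumes "open S" "x \<in> S"
  shows "\<exists>q\<in>\<rat>. q \<in> S"
proof -
  obtain e where e: "e > 0" "ball x e \<subseteq> S" using assms openE by blast
  obtain q where "q \<in> \<rat>" "x < q" "q < x + e" using Rats_dense_in_real[of x "x + e"] e by auto
  then show ?thesis using e(2) by (intro bexI[of _ q]) (auto simp: dist_real_def subset_iff)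
qed

text \<open>All conditions are strict, hence open along a continuous path, so first u and then w can
  be moved to a rational time.\<close>

lemma osc_exceeds_rat_pairs:
  assumes x: "continuous_on UNIV x"
    and uw: "\<bar>u\<bar> < R" "\<bar>w\<bar> < R" "\<bar>u - w\<bar> < \<delta>" "\<bar>x u - x w\<bar> > r"
  shows "x \<in> osc_exceeds (rat_pairs R \<delta>) r"
proof -
  have 1: "open {u. \<bar>u\<bar> < R \<and> \<bar>u - w\<bar> < \<delta> \<and> \<bar>x u - x w\<bar> > r}" for w
    by (intro open_Collect_conj open_Collect_less continuous_intros x)
  obtain u' where u': "u' \<in> \<rat>" "\<bar>u'\<bar> < R" "\<bar>u' - w\<bar> < \<delta>" "\<bar>x u' - x w\<bar> > r"
    using open_contains_rat[OF 1[of w], of u] uw by auto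
  obtain w' where w': "w' \<in> \<rat>" "\<bar>w'\<bar> < R" "\<bar>w' - u'\<bar> < \<delta>" "\<bar>x w' - x u'\<bar> > r"
    using open_contains_rat[OF 1[of u'], of w] uw u' by (auto simp: abs_minus_commute)
  then show ?thesis
    using u' unfolding osc_exceeds_def rat_pairs_def by (auto simp: abs_minus_commute)
qed

text \<open>X is the reference process from which path regularity is taken; Y supplies the
  independent copy for the rotation.\<close>

locale gaussian_pair = prob_space M for M :: "'a measure" +
  fixes X Y :: "'a \<Rightarrow> real \<Rightarrow> real" and K :: "real \<Rightarrow> real \<Rightarrow> real"
  assumes X: "centered_gaussian_process M X K" and Y: "centered_gaussian_process M Y K"
    and XY: "indep_var paths X paths Y"
    and X_cont: "\<And>\<omega>. \<omega> \<in> space M \<Longrightarrow> continuous_on UNIV (X \<omega>)"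
begin

text \<open>The oscillation event lies in the product sigma-algebra, so its probability depends on
  the covariance alone. Levels calibrated on X therefore serve every Z, uniformly in n.\<close>

lemma osc_tail:
  assumes "centered_gaussian_process M Z K" "countable J" "s > 0" "r \<ge> 4 * s"
    and "measure M {\<omega> \<in> space M. X \<omega> \<in> osc_exceeds J s} \<le> 1 / 4"
  shows "measure M {\<omega> \<in> space M. Z \<omega> \<in> osc_exceeds J r} \<le> exp (- r\<^sup>2 / (32 * s\<^sup>2))"
  using fernique[OF prob_space_axioms X Y XY assms(2-5)]
    gaussian_law_unique[OF prob_space_axioms prob_space_axioms assms(1) X osc_exceeds_sets[OF assms(2)]] by simp

lemma osc_event:
  assumes "centered_gaussian_process M Z K" "countable J"
  shows "{\<omega> \<in> space M. Z \<omega> \<in> osc_exceeds J r} \<in> events"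
  using measurable_sets[OF gaussian_process_paths_measurable[OF assms(1)] osc_exceeds_sets[OF assms(2), of r]]
  by (simp add: vimage_def Int_def conj_commute)

text \<open>Continuity from above: no continuous path belongs to all of the decreasing events, so
  their probabilities tend to 0 and pass below the threshold 1/4 of Fernique's inequality.\<close>

lemma decreasing_osc_small:
  assumes J: "\<And>k::nat. countable (J k)"
    and dec: "\<And>k. osc_exceeds (J (Suc k)) (r (Suc k)) \<subseteq> osc_exceeds (J k) (r k)"
    and empty: "\<And>x. continuous_on UNIV x \<Longrightarrow> \<exists>k. x \<notin> osc_exceeds (J k) (r k)"
  shows "\<exists>k. measure M {\<omega> \<in> space M. X \<omega> \<in> osc_exceeds (J k) (r k)} \<le> 1 / 4"
proof -
  let ?E = "\<lambda>k. {\<omega> \<in> space M. X \<omega> \<in> osc_exceeds (J k) (r k)}"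
  have "(\<lambda>k. measure M (?E k)) \<longlonglongrightarrow> measure M (\<Inter>k. ?E k)"
    using dec by (intro finite_Lim_measure_decseq decseq_SucI) (auto intro!: osc_event X J)
  also have "(\<Inter>k. ?E k) = {}"
    using empty X_cont by fastforce
  finally have "eventually (\<lambda>k. measure M (?E k) < 1 / 4) sequentially"
    by (intro order_tendstoD(2)[of _ 0]) auto
  then show ?thesis
    by (metis (no_types, lifting) eventually_sequentially less_imp_le order_refl)
qed

text \<open>The window \<open>\<delta>\<close> is chosen after the rate L: uniform continuity lets a
  smaller window lower the level s at which Fernique's inequality starts, and the exponent is
  governed by the ratio of \<open>\<kappa>\<close> to s.\<close>

lemma modulus_bound:
  assumes "\<kappa> > 0"
  shows "\<exists>\<delta>>0. \<forall>n\<ge>1. \<forall>Z. centered_gaussian_process M Z K \<longrightarrow>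
    measure M {\<omega> \<in> space M. Z \<omega> \<in> osc_exceeds (rat_pairs R \<delta>) (sqrt (real n) * \<kappa>)} \<le> exp (- (real n * L))"
proof -
  \<comment> \<open>At radius sqrt n * \<open>\<kappa>\<close> with s = \<open>\<kappa>\<close> / m
    the exponent is n m^2 / 32. The choice of m makes m^2 / 32 at least L, and m at least 4 as
    Fernique's inequality demands.\<close>
  define m where "m = 6 * (1 + \<bar>L\<bar>)"
  define s where "s = \<kappa> / m"
  have m: "m \<ge> 6" by (simp add: m_def)
  have s: "s > 0" using assms m by (simp add: s_def)
  have "\<exists>k. measure M {\<omega> \<in> space M. X \<omega> \<in> osc_exceeds (rat_pairs R (1 / real (Suc k))) s} \<le> 1 / 4"
  proof (rule decreasing_osc_small)
    fix k
    have "1 / real (Suc (Suc k)) \<le> 1 / real (Suc k)" by (simp add: field_simps)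
    then have "rat_pairs R (1 / real (Suc (Suc k))) \<subseteq> rat_pairs R (1 / real (Suc k))"
      by (auto simp: rat_pairs_def simp del: of_nat_Suc)
    then show "osc_exceeds (rat_pairs R (1 / real (Suc (Suc k)))) s \<subseteq> osc_exceeds (rat_pairs R (1 / real (Suc k))) s"
      by (auto simp: osc_exceeds_def simp del: of_nat_Suc)
  next
    fix x :: "real \<Rightarrow> real" assume "continuous_on UNIV x"
    then have "continuous_on {-R..R} x" by (rule continuous_on_subset) simp
    then have "uniformly_continuous_on {-R..R} x"
      by (intro compact_uniformly_continuous) auto
    then obtain d where d: "d > 0" "\<And>u w. u \<in> {-R..R} \<Longrightarrow> w \<in> {-R..R} \<Longrightarrow> \<bar>w - u\<bar> < d \<Longrightarrow> \<bar>x w - x u\<bar> < s"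
      unfolding uniformly_continuous_on_def dist_real_def using s by meson
    obtain k where "1 / real (Suc k) < d" using d(1) nat_approx_posE by blast
    then have "\<bar>x u - x w\<bar> < s" if "(u, w) \<in> rat_pairs R (1 / real (Suc k))" for u w
      using that by (intro d(2)) (auto simp: rat_pairs_def simp del: of_nat_Suc)
    then show "\<exists>k. x \<notin> osc_exceeds (rat_pairs R (1 / real (Suc k))) s"
      unfolding osc_exceeds_def by (intro exI[of _ k]) (force simp del: of_nat_Suc)
  qed (rule countable_rat_pairs)
  then obtain k where k: "measure M {\<omega> \<in> space M. X \<omega> \<in> osc_exceeds (rat_pairs R (1 / real (Suc k))) s} \<le> 1 / 4" ..
  show ?thesis
  proof (intro exI[of _ "1 / real (Suc k)"] conjI allI impI)
    fix n :: nat and Z assume n: "n \<ge> 1" and Z: "centered_gaussian_process M Z K"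
    have n1: "sqrt (real n) \<ge> 1" using n by simp
    have sk: "\<kappa> = s * m" using m by (simp add: s_def)
    have "4 * s \<le> s * m" using m s by simp
    also have "\<dots> \<le> sqrt (real n) * (s * m)" using mult_right_mono[OF n1, of "s * m"] s m by simp
    finally have r: "4 * s \<le> sqrt (real n) * \<kappa>" unfolding sk .
    have "32 * L \<le> 32 * \<bar>L\<bar>" by simp
    also have "\<dots> \<le> m\<^sup>2"
      by (simp add: m_def power2_eq_square algebra_simps)
    finally have L: "L \<le> m\<^sup>2 / 32" by simp
    have "measure M {\<omega> \<in> space M. Z \<omega> \<in> osc_exceeds (rat_pairs R (1 / real (Suc k))) (sqrt (real n) * \<kappa>)}
       \<le> exp (- (sqrt (real n) * \<kappa>)\<^sup>2 / (32 * s\<^sup>2))"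
      by (intro osc_tail Z countable_rat_pairs s r k)
    also have "- (sqrt (real n) * \<kappa>)\<^sup>2 / (32 * s\<^sup>2) = - (real n * (m\<^sup>2 / 32))"
      using s by (simp add: sk power_mult_distrib)
    also have "exp (- (real n * (m\<^sup>2 / 32))) \<le> exp (- (real n * L))"
      using mult_left_mono[OF L, of "real n"] by simp
    finally show "measure M {\<omega> \<in> space M. Z \<omega> \<in> osc_exceeds (rat_pairs R (1 / real (Suc k))) (sqrt (real n) * \<kappa>)}
       \<le> exp (- (real n * L))" .
  qed simp
qed

text \<open>Here the window is fixed and the level grows instead: a path is bounded on [-1, 1], so
  some level is exceeded with probability at most 1/4. In (-1, 1) the distance bound 2 imposes no
  restriction.\<close>

lemma unit_interval_tail:
  "\<exists>s>0. \<forall>r\<ge>4 * s. \<forall>Z. centered_gaussian_process M Z K \<longrightarrow>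
    measure M {\<omega> \<in> space M. Z \<omega> \<in> osc_exceeds (rat_pairs 1 2) r} \<le> exp (- r\<^sup>2 / (32 * s\<^sup>2))"
proof -
  have "\<exists>k. measure M {\<omega> \<in> space M. X \<omega> \<in> osc_exceeds (rat_pairs 1 2) (real (Suc k))} \<le> 1 / 4"
  proof (rule decreasing_osc_small)
    fix k
    show "osc_exceeds (rat_pairs 1 2) (real (Suc (Suc k))) \<subseteq> osc_exceeds (rat_pairs 1 2) (real (Suc k))"
      by (force simp: osc_exceeds_def)
  next
    fix x :: "real \<Rightarrow> real" assume "continuous_on UNIV x"
    then have "continuous_on {-1..1} x" by (rule continuous_on_subset) simp
    then have "bounded (x ` {-1..1})"
      by (intro compact_imp_bounded compact_continuous_image) auto
    then obtain B where B: "\<And>u. u \<in> {-1..1} \<Longrightarrow> \<bar>x u\<bar> \<le> B"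
      unfolding bounded_iff by (metis imageI real_norm_def)
    obtain k where k: "2 * B < real k" using reals_Archimedean2 by blast
    have "\<bar>x u - x w\<bar> \<le> real (Suc k)" if "(u, w) \<in> rat_pairs 1 2" for u w
    proof -
      have "\<bar>x u\<bar> \<le> B" "\<bar>x w\<bar> \<le> B" using that by (auto intro!: B simp: rat_pairs_def)
      then show ?thesis using k by linarith
    qed
    then show "\<exists>k. x \<notin> osc_exceeds (rat_pairs 1 2) (real (Suc k))"
      unfolding osc_exceeds_def by (intro exI[of _ k]) (force simp del: of_nat_Suc)
  qed (rule countable_rat_pairs)
  then obtain k where k: "measure M {\<omega> \<in> space M. X \<omega> \<in> osc_exceeds (rat_pairs 1 2) (real (Suc k))} \<le> 1 / 4" ..
  show ?thesis
    by (intro exI[of _ "real (Suc k)"] conjI allI impI osc_tail k countable_rat_pairs) auto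
qed

end

section \<open>Growth of paths at infinity\<close>

lemma gaussian_process_shift:
  assumes "centered_gaussian_process M Z (Gam v)" "v 0 = 0"
  shows "centered_gaussian_process M (\<lambda>\<omega> u. Z \<omega> (u + h) - Z \<omega> h) (Gam v)"
proof -
  have "centered_gaussian_process M (\<lambda>\<omega> t. lincomb [(t + h, 1), (h, - 1)] (Z \<omega>)) (Gam v)"
  proof (rule gaussian_process_linear_image[OF assms(1)])
    show "Gam v t w = span_inner (Gam v) [(t + h, 1), (h, - 1)] [(w + h, 1), (h, - 1)]" for t w
      using assms(2) by (simp add: span_inner_lincomb Gam_def field_simps)
  qed
  then show ?thesis by simp
qed

text \<open>Taking \<open>\<beta>\<close> as the minimum of 1 and 2 - \<open>\<alpha>\<close> keeps
  it in (0, 1] however small \<open>\<alpha>\<close> is.\<close>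

lemma growth_bound:
  fixes v :: "real \<Rightarrow> real"
  assumes "\<exists>\<alpha><2. ((\<lambda>t. v t / t powr \<alpha>) \<longlongrightarrow> 0) at_top"
  shows "\<exists>\<beta>>0. \<beta> \<le> 1 \<and> (\<exists>T\<ge>1. \<forall>t\<ge>T. v t \<le> t powr (2 - \<beta>))"
proof -
  obtain \<alpha> where a: "\<alpha> < 2" "((\<lambda>t. v t / t powr \<alpha>) \<longlongrightarrow> 0) at_top" using assms by blast
  have "eventually (\<lambda>t. v t / t powr \<alpha> < 1) at_top"
    using a(2) by (rule order_tendstoD) simp
  then obtain T where T: "\<And>t. t \<ge> T \<Longrightarrow> v t / t powr \<alpha> < 1"
    unfolding eventually_at_top_linorder by blast
  have "v t \<le> t powr (2 - min 1 (2 - \<alpha>))" if "t \<ge> max 1 T" for t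
  proof -
    have "v t \<le> t powr \<alpha>" using T[of t] that by (simp add: divide_less_eq)
    also have "\<dots> \<le> t powr (2 - min 1 (2 - \<alpha>))" using that by (intro powr_mono) auto
    finally show ?thesis .
  qed
  then show ?thesis
    using a(1) by (intro exI[of _ "min 1 (2 - \<alpha>)"] conjI exI[of _ "max 1 T"]) auto
qed

lemma summable_exp_powr:
  assumes "\<kappa> > 0" "\<beta> > 0"
  shows "summable (\<lambda>k. exp (- \<kappa> * real k powr \<beta>))"
proof (rule summable_comparison_test_bigo)
  show "summable (\<lambda>k. norm (real k powr - 2))"
    by (simp add: summable_real_powr_iff)
  show "(\<lambda>k. exp (- \<kappa> * real k powr \<beta>)) \<in> O(\<lambda>k. real k powr - 2)"
    using assms by real_asymp
qed

text \<open>For t in [k, k + 1) a large Z t forces a large Z k or a large increment after k.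
  Chernoff's bound treats the first, with exponent of order k^\<beta>; stationarity and the
  unit-window tail treat the second, with exponent of order k^2. Both are summable, and a late start
  N makes the rate arbitrarily large.\<close>

lemma linear_growth_tail:
  assumes "gaussian_pair M X Y (Gam v)" and v0: "v 0 = 0"
    and v_growth: "\<exists>\<alpha><2. ((\<lambda>t. v t / t powr \<alpha>) \<longlongrightarrow> 0) at_top" and c: "c > 0"
  shows "\<exists>C N. \<forall>n\<ge>1. \<forall>Z. centered_gaussian_process M Z (Gam v) \<longrightarrow>
    (\<forall>\<omega>\<in>space M. continuous_on UNIV (Z \<omega>)) \<longrightarrow>
    outer_le M {\<omega> \<in> space M. \<exists>t\<ge>real N. Z \<omega> t > sqrt (real n) * (c * t)} (C * exp (- (real n * L)))"
proof -
  interpret gaussian_pair M X Y "Gam v" by fact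
  obtain s where s: "s > 0" and st: "\<And>r Z. r \<ge> 4 * s \<Longrightarrow> centered_gaussian_process M Z (Gam v) \<Longrightarrow>
    measure M {\<omega> \<in> space M. Z \<omega> \<in> osc_exceeds (rat_pairs 1 2) r} \<le> exp (- r\<^sup>2 / (32 * s\<^sup>2))"
    using unit_interval_tail by blast
  obtain \<beta> T where \<beta>: "\<beta> > 0" "\<beta> \<le> 1" and T: "T \<ge> 1" "\<And>t. t \<ge> T \<Longrightarrow> v t \<le> t powr (2 - \<beta>)"
    using growth_bound[OF v_growth] by blast
  \<comment> \<open>The first constant is the Chernoff exponent at level c k / 2 for variance k powr
    (2 - \<open>\<beta>\<close>); the second is (c k / 2)^2 / (32 s^2) divided by k^2.\<close>
  define \<kappa> where "\<kappa> = min (c\<^sup>2 / 8) (c\<^sup>2 / (128 * s\<^sup>2))"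
  have \<kappa>: "\<kappa> > 0" using s c by (simp add: \<kappa>_def)
  define a where "a k = exp (- \<kappa> * real k powr \<beta>)" for k
  have sum_a: "summable a" unfolding a_def using \<kappa> \<beta>(1) by (rule summable_exp_powr)
  have a0: "a k \<ge> 0" for k by (simp add: a_def)
  have "eventually (\<lambda>k. \<kappa> * real k powr \<beta> \<ge> L) sequentially"
  proof -
    have "filterlim (\<lambda>k. \<kappa> * real k powr \<beta>) at_top sequentially"
      using \<kappa> \<beta>(1) by real_asymp
    then show ?thesis by (simp add: filterlim_at_top)
  qed
  moreover have "eventually (\<lambda>k. real k \<ge> max T (8 * s / c)) sequentially"
    using filterlim_real_sequentially unfolding filterlim_at_top by blast
  ultimately have "eventually (\<lambda>k. \<kappa> * real k powr \<beta> \<ge> L \<and> real k \<ge> max T (8 * s / c)) sequentially"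
    by (rule eventually_conj)
  then obtain N where N: "\<And>k. k \<ge> N \<Longrightarrow> \<kappa> * real k powr \<beta> \<ge> L" "\<And>k. k \<ge> N \<Longrightarrow> real k \<ge> max T (8 * s / c)"
    unfolding eventually_sequentially by blast
  show ?thesis
  proof (intro exI[of _ "2 * exp L * (\<Sum>k. a (k + N))"] exI[of _ N] allI impI)
    fix n :: nat and Z assume n: "n \<ge> 1" and Z: "centered_gaussian_process M Z (Gam v)"
      and Zc: "\<forall>\<omega>\<in>space M. continuous_on UNIV (Z \<omega>)"
    define W where "W k \<omega> u = Z \<omega> (u + real k) - Z \<omega> (real k)" for k :: nat and \<omega> u
    have W: "centered_gaussian_process M (W k) (Gam v)" for k
      unfolding W_def by (rule gaussian_process_shift[OF Z v0])
    \<comment> \<open>The coefficient is the optimal Chernoff multiplier, level c k / 2 divided by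
      variance, with v k replaced by its bound k powr (2 - \<open>\<beta>\<close>).\<close>
    define G1 where "G1 k = {\<omega> \<in> space M. lincomb [(real k, c * real k / (2 * real k powr (2 - \<beta>)))] (Z \<omega>)
        \<ge> sqrt (real n) * (c\<^sup>2 * (real k)\<^sup>2 / (4 * real k powr (2 - \<beta>)))}" for k
    define G2 where "G2 k = {\<omega> \<in> space M. W k \<omega> \<in> osc_exceeds (rat_pairs 1 2) (sqrt (real n) * (c * real k / 2))}" for k
    have mG: "G1 k \<in> events" "G2 k \<in> events" for k
    proof -
      have [measurable]: "(\<lambda>\<omega>. lincomb cs (Z \<omega>)) \<in> borel_measurable M" for cs
        by (intro lincomb_measurable gaussian_process_measurable[OF Z])
      show "G1 k \<in> events" unfolding G1_def by measurable
      show "G2 k \<in> events" unfolding G2_def by (intro osc_event W countable_rat_pairs)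
    qed
    \<comment> \<open>One of the n copies of the exponent is kept for summability over k; the other
      n - 1 are each at least L by the choice of N.\<close>
    have exp_le: "exp (- (real n * (\<kappa> * real k powr \<beta>))) \<le> a k * (exp L * exp (- (real n * L)))" if "k \<ge> N" for k
    proof -
      have "(real n - 1) * L \<le> (real n - 1) * (\<kappa> * real k powr \<beta>)"
        using N(1)[OF that] n by (intro mult_left_mono) auto
      then have "- (real n * (\<kappa> * real k powr \<beta>)) \<le> - \<kappa> * real k powr \<beta> + (L + - (real n * L))"
        by (simp add: algebra_simps)
      then show ?thesis unfolding a_def exp_add[symmetric] by simp
    qed
    have k1: "real k \<ge> 1" if "k \<ge> N" for k using N(2)[OF that] T(1) by simp
    have pG1: "measure M (G1 k) \<le> exp (- (real n * (\<kappa> * real k powr \<beta>)))" if k: "k \<ge> N" for k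
    proof -
      define D where "D = real k powr (2 - \<beta>)"
      have D: "D > 0" using k1[OF k] by (simp add: D_def)
      have kD: "(real k)\<^sup>2 = D * real k powr \<beta>"
      proof -
        have "D * real k powr \<beta> = real k powr 2" by (simp add: D_def powr_add[symmetric])
        then show ?thesis using k1[OF k] by simp
      qed
      have vD: "v (real k) \<le> D" using T(2) N(2)[OF k] by (simp add: D_def)
      have "measure M (G1 k) \<le> exp (real n * ((c * real k / (2 * D))\<^sup>2 * v (real k) / 2 - c\<^sup>2 * (real k)\<^sup>2 / (4 * D)))"
        unfolding G1_def D_def[symmetric]
        by (rule order_trans[OF chernoff[OF prob_space_axioms Z]])
          (simp add: span_inner_lincomb Gam_def v0 power2_eq_square mult.assoc)
      moreover have "(c * real k / (2 * D))\<^sup>2 * v (real k) / 2 - c\<^sup>2 * (real k)\<^sup>2 / (4 * D) \<le> - (\<kappa> * real k powr \<beta>)"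
      proof -
        have "(c * real k / (2 * D))\<^sup>2 * v (real k) / 2 \<le> (c * real k / (2 * D))\<^sup>2 * D / 2"
          using vD by (intro divide_right_mono mult_left_mono) auto
        also have "\<dots> = c\<^sup>2 * (real k)\<^sup>2 / (8 * D)"
          using D by (simp add: power2_eq_square field_simps)
        finally have "(c * real k / (2 * D))\<^sup>2 * v (real k) / 2 - c\<^sup>2 * (real k)\<^sup>2 / (4 * D)
            \<le> c\<^sup>2 * (real k)\<^sup>2 / (8 * D) - c\<^sup>2 * (real k)\<^sup>2 / (4 * D)"
          by simp
        also have "\<dots> = - (c\<^sup>2 / 8 * real k powr \<beta>)"
          unfolding kD using D by (simp add: field_simps)
        also have "\<dots> \<le> - (\<kappa> * real k powr \<beta>)"
          using mult_right_mono[of \<kappa> "c\<^sup>2 / 8" "real k powr \<beta>"] by (simp add: \<kappa>_def)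
        finally show ?thesis .
      qed
      then have "real n * ((c * real k / (2 * D))\<^sup>2 * v (real k) / 2 - c\<^sup>2 * (real k)\<^sup>2 / (4 * D))
          \<le> - (real n * (\<kappa> * real k powr \<beta>))"
        using mult_left_mono[of _ _ "real n"] by fastforce
      ultimately show ?thesis by (meson exp_le_cancel_iff order_trans)
    qed
    have pG2: "measure M (G2 k) \<le> exp (- (real n * (\<kappa> * real k powr \<beta>)))" if k: "k \<ge> N" for k
    proof -
      have "4 * s \<le> c * real k / 2" using N(2)[OF k] c by (simp add: field_simps)
      also have "\<dots> \<le> sqrt (real n) * (c * real k / 2)"
        using mult_right_mono[of 1 "sqrt (real n)" "c * real k / 2"] n c by simp
      finally have "measure M (G2 k) \<le> exp (- (sqrt (real n) * (c * real k / 2))\<^sup>2 / (32 * s\<^sup>2))"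
        unfolding G2_def by (intro st W)
      also have "(sqrt (real n) * (c * real k / 2))\<^sup>2 / (32 * s\<^sup>2) = real n * (c\<^sup>2 / (128 * s\<^sup>2) * (real k)\<^sup>2)"
        using s by (simp add: power_mult_distrib power_divide field_simps)
      then have "exp (- (sqrt (real n) * (c * real k / 2))\<^sup>2 / (32 * s\<^sup>2)) = exp (- (real n * (c\<^sup>2 / (128 * s\<^sup>2) * (real k)\<^sup>2)))"
        by simp
      also have "\<dots> \<le> exp (- (real n * (\<kappa> * real k powr \<beta>)))"
      proof -
        have "real k powr \<beta> \<le> real k powr 2" using k1[OF k] \<beta> by (intro powr_mono) auto
        then have "real k powr \<beta> \<le> (real k)\<^sup>2" using k1[OF k] by simp
        then have "\<kappa> * real k powr \<beta> \<le> c\<^sup>2 / (128 * s\<^sup>2) * (real k)\<^sup>2"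
          using \<kappa> by (intro mult_mono) (auto simp: \<kappa>_def)
        then have "real n * (\<kappa> * real k powr \<beta>) \<le> real n * (c\<^sup>2 / (128 * s\<^sup>2) * (real k)\<^sup>2)"
          by (rule mult_left_mono) simp
        then show ?thesis by (simp only: exp_le_cancel_iff neg_le_iff_le)
      qed
      finally show ?thesis .
    qed
    define b where "b k = 2 * (exp L * exp (- (real n * L))) * a (k + N)" for k
    have b_eq: "b k = a (k + N) * (exp L * exp (- (real n * L))) + a (k + N) * (exp L * exp (- (real n * L)))" for k
      by (simp add: b_def)
    have pG: "measure M (G1 (k + N) \<union> G2 (k + N)) \<le> b k" for k
      using measure_Un_le[OF mG(1) mG(2), of "k + N" "k + N"] pG1[of "k + N"] pG2[of "k + N"] exp_le[of "k + N"]
      unfolding b_eq by linarith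
    have sum_b: "summable b"
      unfolding b_def using sum_a by (intro summable_mult) (simp add: summable_iff_shift)
    have sum_G: "summable (\<lambda>k. measure M (G1 (k + N) \<union> G2 (k + N)))"
      using pG by (intro summable_comparison_test'[OF sum_b, of 0]) auto
    have mU: "range (\<lambda>k. G1 (k + N) \<union> G2 (k + N)) \<subseteq> events" using mG by auto
    have "measure M (\<Union>k. G1 (k + N) \<union> G2 (k + N)) \<le> (\<Sum>k. measure M (G1 (k + N) \<union> G2 (k + N)))"
      by (rule finite_measure_subadditive_countably[OF mU sum_G])
    also have "\<dots> \<le> (\<Sum>k. b k)" by (intro suminf_le pG sum_G sum_b)
    also have "\<dots> = 2 * exp L * (\<Sum>k. a (k + N)) * exp (- (real n * L))"
      unfolding b_def using sum_a by (subst suminf_mult) (auto simp: summable_iff_shift)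
    finally have le: "measure M (\<Union>k. G1 (k + N) \<union> G2 (k + N)) \<le> 2 * exp L * (\<Sum>k. a (k + N)) * exp (- (real n * L))" .
    show "outer_le M {\<omega> \<in> space M. \<exists>t\<ge>real N. Z \<omega> t > sqrt (real n) * (c * t)} (2 * exp L * (\<Sum>k. a (k + N)) * exp (- (real n * L)))"
    proof (rule outer_leI[OF _ _ le])
      show "{\<omega> \<in> space M. \<exists>t\<ge>real N. Z \<omega> t > sqrt (real n) * (c * t)} \<subseteq> (\<Union>k. G1 (k + N) \<union> G2 (k + N))"
      proof safe
        fix \<omega> t assume w: "\<omega> \<in> space M" and t: "t \<ge> real N" "Z \<omega> t > sqrt (real n) * (c * t)"
        define k where "k = nat \<lfloor>t\<rfloor>"
        have k: "real k \<le> t" "t < real k + 1" using t(1) by (simp_all add: k_def)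
        have kN: "k \<ge> N" using t(1) by (auto simp: k_def le_nat_floor)
        have "sqrt (real n) * (c * real k) \<le> sqrt (real n) * (c * t)"
          using k c by (intro mult_left_mono) auto
        then have "Z \<omega> t > sqrt (real n) * (c * real k)" using t(2) by linarith
        \<comment> \<open>Half of the level c k goes to the grid point and half to the
          increment.\<close>
        then consider "Z \<omega> (real k) \<ge> sqrt (real n) * (c * real k / 2)" | "Z \<omega> t - Z \<omega> (real k) > sqrt (real n) * (c * real k / 2)"
          by fastforce
        then have "\<omega> \<in> G1 k \<union> G2 k"
        proof cases
          case 1
          let ?p = "c * real k / (2 * real k powr (2 - \<beta>))"
          have "?p * (sqrt (real n) * (c * real k / 2)) \<le> ?p * Z \<omega> (real k)"
            using 1 c by (intro mult_left_mono) auto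
          moreover have "?p * (sqrt (real n) * (c * real k / 2)) =
              sqrt (real n) * (c\<^sup>2 * (real k)\<^sup>2 / (4 * real k powr (2 - \<beta>)))"
            by (simp add: power2_eq_square)
          ultimately have "sqrt (real n) * (c\<^sup>2 * (real k)\<^sup>2 / (4 * real k powr (2 - \<beta>))) \<le> ?p * Z \<omega> (real k)"
            by (simp only:)
          then have "\<omega> \<in> G1 k" using w unfolding G1_def by (simp only: mem_Collect_eq lincomb_Cons lincomb_Nil fst_conv snd_conv add_0_right)
          then show ?thesis by simp
        next
          case 2
          have "continuous_on UNIV (Z \<omega>)" using Zc w by blast
          then have "continuous_on UNIV (\<lambda>u. Z \<omega> (u + real k))"
            by (rule continuous_on_compose2) (auto intro!: continuous_intros)
          then have cW: "continuous_on UNIV (W k \<omega>)" unfolding W_def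
            by (intro continuous_on_diff continuous_on_const)
          have "\<bar>W k \<omega> (t - real k) - W k \<omega> 0\<bar> > sqrt (real n) * (c * real k / 2)"
            unfolding W_def using order.strict_trans2[OF 2 abs_ge_self] by simp
          then have "W k \<omega> \<in> osc_exceeds (rat_pairs 1 2) (sqrt (real n) * (c * real k / 2))"
            using k by (intro osc_exceeds_rat_pairs[OF cW, of "t - real k" _ 0]) auto
          then show ?thesis using w by (simp add: G2_def)
        qed
        then show "\<omega> \<in> (\<Union>k. G1 (k + N) \<union> G2 (k + N))"
          using kN by (intro UN_I[of "k - N"]) auto
      qed
    qed (use mU in auto)
  qed
qed

section \<open>The rate function on finite spans\<close>

lemma Gam_commute: "Gam v s t = Gam v t s"
  by (simp add: Gam_def abs_minus_commute)

lemma Gam_minus: "Gam v (- s) (- t) = Gam v s t"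
proof -
  have "\<bar>s - t\<bar> = \<bar>t - s\<bar>" by (rule abs_minus_commute)
  then show ?thesis by (simp add: Gam_def)
qed

lemma lincomb_span_diff: "lincomb (span_diff xs ys) x = lincomb xs x - lincomb ys x"
proof -
  have "lincomb (map (\<lambda>(u, b). (u, - b)) ys) x = - lincomb ys x"
    using lincomb_scale[of "- 1" ys x] by simp
  then show ?thesis by (simp add: span_diff_def)
qed

lemma lincomb_diff: "lincomb cs (\<lambda>t. x t - y t) = lincomb cs x - lincomb cs y"
  by (induction cs) (auto simp: algebra_simps)

lemma lincomb_tendsto:
  assumes "\<And>t. (\<lambda>k. x k t) \<longlonglongrightarrow> y t"
  shows "(\<lambda>k. lincomb cs (x k)) \<longlonglongrightarrow> lincomb cs y"
  by (induction cs) (auto intro!: tendsto_intros assms)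

lemma span_fun_lincomb: "span_fun K xs t = lincomb xs (\<lambda>s. K s t)"
  by (simp add: span_fun_def lincomb_def)

lemma span_inner_diff_diff:
  assumes "\<And>s u. K s u = K u s"
  shows "span_inner K (span_diff xs ys) (span_diff xs ys) =
    span_inner K xs xs - 2 * span_inner K xs ys + span_inner K ys ys"
proof -
  have "span_inner K ys xs = span_inner K xs ys"
    unfolding span_inner_lincomb by (subst lincomb_swap) (simp add: assms[symmetric])
  then show ?thesis
    by (simp add: span_inner_lincomb lincomb_span_diff lincomb_diff)
qed

text \<open>The norm is defined through an arbitrarily chosen approximating sequence, so every such
  sequence must give the same limit. The differences h k = g k - ys are Cauchy in norm, and
  pointwise convergence makes their inner products with finite kernel sums vanish; expanding the
  squared norm of h k - h N then bounds that of h k.\<close>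

lemma rkhs_approx_norm_tendsto:
  assumes sym: "\<And>s u. K s u = K u s" and psd: "\<And>cs. span_inner K cs cs \<ge> 0"
    and g: "rkhs_approx K g (span_fun K ys)"
  shows "(\<lambda>k. span_inner K (g k) (g k)) \<longlonglongrightarrow> span_inner K ys ys"
proof -
  have inner: "span_inner K xs zs = lincomb zs (span_fun K xs)" for xs zs
    unfolding span_inner_lincomb by (subst lincomb_swap) (simp add: span_fun_lincomb[abs_def])
  have lim: "(\<lambda>k. span_inner K (g k) zs) \<longlonglongrightarrow> span_inner K ys zs" for zs
    unfolding inner using g by (intro lincomb_tendsto) (auto simp: rkhs_approx_def)
  define h where "h k = span_diff (g k) ys" for k
  have hdiff: "span_inner K (span_diff (h k) (h m)) (span_diff (h k) (h m)) =
      span_inner K (span_diff (g k) (g m)) (span_diff (g k) (g m))" for k m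
    unfolding h_def by (simp add: span_inner_lincomb lincomb_span_diff lincomb_diff)
  have "(\<lambda>k. span_inner K (h k) (h k)) \<longlonglongrightarrow> 0"
  proof (rule LIMSEQ_I)
    fix e :: real assume "e > 0"
    then have e: "e / 2 > 0" by simp
    then obtain N where N: "\<And>k m. k \<ge> N \<Longrightarrow> m \<ge> N \<Longrightarrow>
        span_inner K (span_diff (g k) (g m)) (span_diff (g k) (g m)) < e / 2"
      using g unfolding rkhs_approx_def by blast
    have "(\<lambda>k. 2 * (span_inner K (g k) (h N) - span_inner K ys (h N))) \<longlonglongrightarrow> 2 * (span_inner K ys (h N) - span_inner K ys (h N))"
      by (intro tendsto_intros lim)
    then have "eventually (\<lambda>k. 2 * (span_inner K (g k) (h N) - span_inner K ys (h N)) < e / 2) sequentially"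
      using e by (intro order_tendstoD(2)) auto
    then obtain N' where N': "\<And>k. k \<ge> N' \<Longrightarrow> 2 * (span_inner K (g k) (h N) - span_inner K ys (h N)) < e / 2"
      unfolding eventually_sequentially by blast
    show "\<exists>no. \<forall>k\<ge>no. norm (span_inner K (h k) (h k) - 0) < e"
    proof (intro exI[of _ "max N N'"] allI impI)
      fix k assume k: "k \<ge> max N N'"
      have "span_inner K (h k) (h N) = span_inner K (g k) (h N) - span_inner K ys (h N)"
        unfolding h_def[of k] by (simp add: span_inner_lincomb lincomb_span_diff)
      then have "span_inner K (span_diff (g k) (g N)) (span_diff (g k) (g N)) =
          span_inner K (h k) (h k) - 2 * (span_inner K (g k) (h N) - span_inner K ys (h N)) + span_inner K (h N) (h N)"
        using span_inner_diff_diff[where K = K, OF sym, where xs = "h k" and ys = "h N"] unfolding hdiff by simp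
      moreover have "span_inner K (span_diff (g k) (g N)) (span_diff (g k) (g N)) < e / 2" using N k by simp
      moreover have "2 * (span_inner K (g k) (h N) - span_inner K ys (h N)) < e / 2" using N' k by simp
      ultimately have "span_inner K (h k) (h k) < e" using psd[of "h N"] by linarith
      then show "norm (span_inner K (h k) (h k) - 0) < e" using psd[of "h k"] by simp
    qed
  qed
  then have "(\<lambda>k. span_inner K (h k) (h k) + 2 * span_inner K (g k) ys - span_inner K ys ys)
      \<longlonglongrightarrow> 0 + 2 * span_inner K ys ys - span_inner K ys ys"
    by (intro tendsto_intros lim)
  then show ?thesis
    unfolding h_def span_inner_diff_diff[where K = K, OF sym] by simp
qed

text \<open>The constant sequence shows membership; the sequence picked by \<open>SOME\<close> may
  be another one, but it has the same limiting norm.\<close>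

lemma rateI_span_fun:
  assumes sym: "\<And>s u. K s u = K u s" and psd: "\<And>cs. span_inner K cs cs \<ge> 0"
  shows "rateI K (span_fun K ys) = ereal (span_inner K ys ys / 2)"
proof -
  have ex: "rkhs_approx K (\<lambda>_. ys) (span_fun K ys)"
    by (auto simp: rkhs_approx_def span_inner_lincomb lincomb_span_diff)
  then have "rkhs_approx K (SOME g. rkhs_approx K g (span_fun K ys)) (span_fun K ys)"
    by (rule someI[where P = "\<lambda>g. rkhs_approx K g (span_fun K ys)"])
  from rkhs_approx_norm_tendsto[OF sym psd this] have "rkhs_norm_sq K (span_fun K ys) = span_inner K ys ys"
    unfolding rkhs_norm_sq_def by (rule limI)
  then show ?thesis using ex by (auto simp: rateI_def rkhs_def)
qed

section \<open>Quadratic programming with two constraints\<close>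

lemma psd_discriminant:
  fixes p q r :: real
  assumes psd: "\<And>a b. a\<^sup>2 * p + 2 * a * b * q + b\<^sup>2 * r \<ge> 0"
  shows "q\<^sup>2 \<le> p * r"
proof (cases "r > 0")
  case True
  \<comment> \<open>The test vector (r, -q) is, up to scaling, the minimiser of the form along lines
    of constant a.\<close>
  have "r * (p * r - q\<^sup>2) \<ge> 0"
    using psd[of r "- q"] by (simp add: power2_eq_square algebra_simps)
  then show ?thesis using True by (simp add: zero_le_mult_iff)
next
  case False
  then have r: "r = 0" using psd[of 0 1] by simp
  have "q = 0"
  proof (rule ccontr)
    assume q: "q \<noteq> 0"
    \<comment> \<open>With r = 0 the form is affine in b; this b makes its value -1.\<close>
    have "p + 2 * (- (p + 1) / (2 * q)) * q \<ge> 0"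
      using psd[of 1 "- (p + 1) / (2 * q)"] r by simp
    then show False using q by (simp add: field_simps)
  qed
  then show ?thesis using r by simp
qed

text \<open>The form may be degenerate, but then a null direction inside the quadrant would make the dual
  objective unbounded; otherwise one of the three candidate optima (one or both constraints active)
  has nonnegative multipliers.\<close>

lemma quadrant_duality:
  fixes p q r x y L :: real
  assumes psd: "\<And>a b. a\<^sup>2 * p + 2 * a * b * q + b\<^sup>2 * r \<ge> 0" and x: "x > 0"
    and dual: "\<And>l m. l \<ge> 0 \<Longrightarrow> m \<ge> 0 \<Longrightarrow> l * x + m * y - (l\<^sup>2 * p + 2 * l * m * q + m\<^sup>2 * r) / 2 \<le> L"
  shows "\<exists>l m. l * p + m * q \<ge> x \<and> l * q + m * r \<ge> y \<and> (l\<^sup>2 * p + 2 * l * m * q + m\<^sup>2 * r) / 2 \<le> L"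
proof -
  have p0: "p \<ge> 0" and r0: "r \<ge> 0" using psd[of 1 0] psd[of 0 1] by auto
  have disc: "q\<^sup>2 \<le> p * r" by (rule psd_discriminant[OF psd])
  have no_null: "l * x + m * y \<le> 0" if lm: "l \<ge> 0" "m \<ge> 0" and null: "l\<^sup>2 * p + 2 * l * m * q + m\<^sup>2 * r = 0" for l m
  proof (rule ccontr)
    assume "\<not> ?thesis"
    then have pos: "l * x + m * y > 0" by simp
    \<comment> \<open>Along a null direction the dual objective is linear; this scaling makes it |L|
      + 1, above the assumed bound.\<close>
    define k where "k = (\<bar>L\<bar> + 1) / (l * x + m * y)"
    have k: "k \<ge> 0" using pos by (simp add: k_def)
    have d: "(k * l) * x + (k * m) * y - ((k * l)\<^sup>2 * p + 2 * (k * l) * (k * m) * q + (k * m)\<^sup>2 * r) / 2 \<le> L"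
      using k lm by (intro dual) auto
    have z: "(k * l)\<^sup>2 * p + 2 * (k * l) * (k * m) * q + (k * m)\<^sup>2 * r = 0"
    proof -
      have "(k * l)\<^sup>2 * p + 2 * (k * l) * (k * m) * q + (k * m)\<^sup>2 * r = k\<^sup>2 * (l\<^sup>2 * p + 2 * l * m * q + m\<^sup>2 * r)"
        by (simp add: power2_eq_square algebra_simps)
      then show ?thesis unfolding null by simp
    qed
    have e: "(k * l) * x + (k * m) * y = \<bar>L\<bar> + 1"
    proof -
      have "(k * l) * x + (k * m) * y = k * (l * x + m * y)" by (simp add: algebra_simps)
      then show ?thesis using pos by (simp add: k_def)
    qed
    show False using d unfolding z e by simp
  qed
  have p: "p > 0"
  proof (rule ccontr)
    assume "\<not> p > 0"
    then have "p = 0" using p0 by simp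
    then show False using no_null[of 1 0] x by simp
  qed
  show ?thesis
  proof (cases "q * x \<ge> y * p")
    case True
    \<comment> \<open>Only the first constraint is active: the unconstrained optimum with m = 0
      already satisfies the second, which is the case condition.\<close>
    have "(x / p)\<^sup>2 * p = x / p * x" using p by (simp add: power2_eq_square)
    then have "(x / p)\<^sup>2 * p / 2 \<le> L" using dual[of "x / p" 0] x p by simp
    then show ?thesis using True p by (intro exI[of _ "x / p"] exI[of _ 0]) (simp add: field_simps)
  next
    case F1: False
    show ?thesis
    proof (cases "y > 0 \<and> r > 0 \<and> q * y \<ge> x * r")
      case True
      \<comment> \<open>The mirror case, with only the second constraint active.\<close>
      then have "(y / r)\<^sup>2 * r = y / r * y" by (simp add: power2_eq_square)
      then have "(y / r)\<^sup>2 * r / 2 \<le> L" using dual[of 0 "y / r"] True by simp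
      then show ?thesis using True by (intro exI[of _ 0] exI[of _ "y / r"]) (simp add: field_simps)
    next
      case F2: False
      define D where "D = p * r - q\<^sup>2"
      \<comment> \<open>With both constraints to be active, the matrix must be regular. If D = 0 and
        q > 0, the rows are proportional and the failed conditions \<open>F1\<close> and
        \<open>F2\<close> contradict each other.\<close>
      have D: "D > 0"
      proof (rule ccontr)
        assume "\<not> D > 0"
        then have D0: "p * r = q\<^sup>2" using disc by (simp add: D_def)
        show False
        proof (cases "q > 0")
          case True
          have "p * y > x * q" using F1 by (simp add: mult.commute)
          then have y: "y > 0" using True x p by (smt (verit) mult_nonneg_nonpos mult_pos_pos)
          have "r > 0" using D0 True p by (metis zero_less_mult_pos zero_less_power)
          then have "q * y < x * r" using F2 y by auto
          then have "p * (q * y) < p * (x * r)" using p by simp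
          also have "p * (x * r) = q * (x * q)" using D0 by (simp add: power2_eq_square algebra_simps)
          finally have "q * (p * y) < q * (x * q)" by (simp add: algebra_simps)
          then show False using \<open>p * y > x * q\<close> True by simp
        next
          case False
          \<comment> \<open>For q at most 0 the vector (-q, p) is a null direction inside the
            quadrant, and by \<open>F1\<close> its linear part is positive.\<close>
          have "(- q)\<^sup>2 * p + 2 * (- q) * p * q + p\<^sup>2 * r = p * (p * r - q\<^sup>2)"
            by (simp add: power2_eq_square algebra_simps)
          then have "(- q)\<^sup>2 * p + 2 * (- q) * p * q + p\<^sup>2 * r = 0" using D0 by simp
          then have "- q * x + p * y \<le> 0" using False p by (intro no_null) auto
          then show False using F1 by (simp add: algebra_simps)
        qed
      qed
      \<comment> \<open>Cramer's rule for both constraints holding with equality; the failed cases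
        make the multipliers nonnegative, so the dual bound applies to them.\<close>
      define l m where "l = (x * r - y * q) / D" and "m = (y * p - x * q) / D"
      have "r \<noteq> 0"
      proof
        assume "r = 0"
        then have "D = - (q\<^sup>2)" by (simp add: D_def)
        then show False using D by simp
      qed
      then have "r > 0" using r0 by simp
      have m0: "m \<ge> 0" using F1 D unfolding m_def by (intro divide_nonneg_pos) (auto simp: mult.commute)
      have l0: "l \<ge> 0"
      proof (cases "y > 0")
        case True
        then show ?thesis using F2 \<open>r > 0\<close> D unfolding l_def
          by (intro divide_nonneg_pos) (auto simp: mult.commute)
      next
        case False
        have "q * x < y * p" using F1 by simp
        moreover have "y * p \<le> 0" using False p by (simp add: mult_nonpos_nonneg)
        ultimately have "q * x < 0" by linarith
        then have "q < 0" using x by (simp add: mult_less_0_iff)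
        have "p * (y * q) = q * (y * p)" by (simp add: ac_simps)
        also have "\<dots> \<le> q * (q * x)"
          using \<open>q < 0\<close> \<open>q * x < y * p\<close> by (intro mult_left_mono_neg) auto
        also have "\<dots> = q\<^sup>2 * x" by (simp add: power2_eq_square)
        also have "\<dots> \<le> p * r * x" using disc x by (intro mult_right_mono) auto
        also have "\<dots> = p * (x * r)" by (simp add: ac_simps)
        finally have "y * q \<le> x * r" using p by simp
        then show ?thesis using D by (simp add: l_def)
      qed
      have e1: "l * p + m * q = x"
      proof -
        have "l * p + m * q = x * (p * r - q\<^sup>2) / D" unfolding l_def m_def
          by (simp add: add_divide_distrib[symmetric] power2_eq_square algebra_simps)
        then show ?thesis using D by (simp add: D_def)
      qed
      have e2: "l * q + m * r = y"
      proof -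
        have "l * q + m * r = y * (p * r - q\<^sup>2) / D" unfolding l_def m_def
          by (simp add: add_divide_distrib[symmetric] power2_eq_square algebra_simps)
        then show ?thesis using D by (simp add: D_def)
      qed
      have "l\<^sup>2 * p + 2 * l * m * q + m\<^sup>2 * r = l * (l * p + m * q) + m * (l * q + m * r)"
        by (simp add: power2_eq_square algebra_simps)
      also have "\<dots> = l * x + m * y" by (simp add: e1 e2)
      finally have "(l\<^sup>2 * p + 2 * l * m * q + m\<^sup>2 * r) / 2 \<le> L"
        using dual[OF l0 m0] by (simp add: field_simps)
      then show ?thesis using e1 e2 by (metis order_refl)
    qed
  qed
qed

section \<open>Dual multipliers and the bound for bounded crossing times\<close>

lemma Gam_diag: "v 0 = 0 \<Longrightarrow> Gam v t t = v \<bar>t\<bar>"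
  by (simp add: Gam_def)

lemma Gam_Cauchy_Schwarz:
  assumes psd: "\<And>cs. span_inner (Gam v) cs cs \<ge> 0" and v0: "v 0 = 0"
  shows "(Gam v s t)\<^sup>2 \<le> v \<bar>s\<bar> * v \<bar>t\<bar>"
proof (rule psd_discriminant)
  fix a b :: real
  have "span_inner (Gam v) [(s, a), (t, b)] [(s, a), (t, b)] = a\<^sup>2 * v \<bar>s\<bar> + 2 * a * b * Gam v s t + b\<^sup>2 * v \<bar>t\<bar>"
    using v0 Gam_commute[of v t s] by (simp add: span_inner_lincomb Gam_diag power2_eq_square algebra_simps)
  then show "a\<^sup>2 * v \<bar>s\<bar> + 2 * a * b * Gam v s t + b\<^sup>2 * v \<bar>t\<bar> \<ge> 0"
    using psd by metis
qed

text \<open>Cauchy-Schwarz bounds |Gam v s t| by sqrt (v |s| * v |t|), hence by a constant times t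
  powr (1 - \<open>\<beta>\<close> / 2), which is sublinear although v itself may grow faster than
  linearly.\<close>

lemma Gam_sublinear:
  assumes psd: "\<And>cs. span_inner (Gam v) cs cs \<ge> 0" and v0: "v 0 = 0"
    and v_growth: "\<exists>\<alpha><2. ((\<lambda>t. v t / t powr \<alpha>) \<longlongrightarrow> 0) at_top"
  shows "((\<lambda>t. Gam v s t / (1 + \<bar>t\<bar>)) \<longlongrightarrow> 0) at_top"
proof -
  obtain \<beta> T where \<beta>: "\<beta> > 0" "\<beta> \<le> 1" and T: "T \<ge> 1" "\<And>t. t \<ge> T \<Longrightarrow> v t \<le> t powr (2 - \<beta>)"
    using growth_bound[OF v_growth] by blast
  have vs: "v \<bar>s\<bar> \<ge> 0" using psd[of "[(s, 1)]"] v0 by (simp add: span_inner_lincomb Gam_diag)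
  have "eventually (\<lambda>t. norm (Gam v s t / (1 + \<bar>t\<bar>)) \<le> sqrt (v \<bar>s\<bar>) * (t powr (1 - \<beta> / 2) / (1 + \<bar>t\<bar>))) at_top"
    using eventually_ge_at_top[of T]
  proof eventually_elim
    case (elim t)
    have "(Gam v s t)\<^sup>2 \<le> v \<bar>s\<bar> * v \<bar>t\<bar>" by (rule Gam_Cauchy_Schwarz[OF psd v0])
    also have "\<dots> \<le> v \<bar>s\<bar> * t powr (2 - \<beta>)"
      using T elim vs by (intro mult_left_mono) auto
    finally have "sqrt ((Gam v s t)\<^sup>2) \<le> sqrt (v \<bar>s\<bar> * t powr (2 - \<beta>))" by (rule real_sqrt_le_mono)
    also have "\<dots> = sqrt (v \<bar>s\<bar>) * t powr (1 - \<beta> / 2)"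
      using elim T(1) by (simp add: real_sqrt_mult powr_half_sqrt[symmetric] powr_powr diff_divide_distrib)
    finally have "\<bar>Gam v s t\<bar> \<le> sqrt (v \<bar>s\<bar>) * t powr (1 - \<beta> / 2)" by simp
    then have "\<bar>Gam v s t\<bar> / (1 + \<bar>t\<bar>) \<le> sqrt (v \<bar>s\<bar>) * t powr (1 - \<beta> / 2) / (1 + \<bar>t\<bar>)"
      by (rule divide_right_mono) simp
    then show ?case by simp
  qed
  moreover have "((\<lambda>t. t powr (1 - \<beta> / 2) / (1 + \<bar>t\<bar>)) \<longlongrightarrow> 0) at_top"
    using \<beta>(1) by real_asymp
  then have "((\<lambda>t. sqrt (v \<bar>s\<bar>) * (t powr (1 - \<beta> / 2) / (1 + \<bar>t\<bar>))) \<longlongrightarrow> 0) at_top"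
    by (rule tendsto_mult_right_zero)
  ultimately show ?thesis by (rule Lim_null_comparison)
qed

text \<open>Candidate minimisers must be genuine elements of the path space before they can compete
  in \<open>Uset\<close>. Behaviour at minus infinity follows from the symmetry
  \<open>Gam_minus\<close>.\<close>

lemma span_fun_Omega:
  assumes psd: "\<And>cs. span_inner (Gam v) cs cs \<ge> 0" and v0: "v 0 = 0" and v_cont: "continuous_on {0..} v"
    and v_growth: "\<exists>\<alpha><2. ((\<lambda>t. v t / t powr \<alpha>) \<longlongrightarrow> 0) at_top"
  shows "span_fun (Gam v) ys \<in> Omega"
proof -
  have Gam: "Gam v s \<in> Omega" for s
  proof -
    have "continuous_on UNIV (\<lambda>t. v \<bar>t - s\<bar>)" for s
      by (rule continuous_on_compose2[OF v_cont]) (auto intro!: continuous_intros)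
    from this[of s] this[of 0] have "continuous_on UNIV (\<lambda>t. (v \<bar>s\<bar> + v \<bar>t\<bar> - v \<bar>t - s\<bar>) / 2)"
      by (auto intro!: continuous_intros)
    then have c: "continuous_on UNIV (Gam v s)" by (simp add: Gam_def[abs_def])
    have "((\<lambda>t. Gam v s (- t) / (1 + \<bar>t\<bar>)) \<longlongrightarrow> 0) at_top"
      using Gam_sublinear[OF psd v0 v_growth, of "- s"] Gam_minus[of v "- s"] by simp
    then have "((\<lambda>t. Gam v s t / (1 + \<bar>t\<bar>)) \<longlongrightarrow> 0) at_bot"
      unfolding at_bot_mirror filterlim_filtermap by simp
    then show ?thesis
      using c Gam_sublinear[OF psd v0 v_growth, of s] v0 by (simp add: Omega_def) (simp add: Gam_def)
  qed
  have "(\<lambda>t. lincomb ys (\<lambda>s. Gam v s t)) \<in> Omega"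
  proof (induction ys)
    case (Cons p ys)
    have *: "(\<lambda>t. (snd p * Gam v (fst p) t + lincomb ys (\<lambda>s. Gam v s t)) / (1 + \<bar>t\<bar>)) =
       (\<lambda>t. snd p * (Gam v (fst p) t / (1 + \<bar>t\<bar>)) + lincomb ys (\<lambda>s. Gam v s t) / (1 + \<bar>t\<bar>))"
      by (simp add: add_divide_distrib)
    have L: "((\<lambda>t. (snd p * Gam v (fst p) t + lincomb ys (\<lambda>s. Gam v s t)) / (1 + \<bar>t\<bar>)) \<longlongrightarrow> 0) F"
      if "((\<lambda>t. Gam v (fst p) t / (1 + \<bar>t\<bar>)) \<longlongrightarrow> 0) F" "((\<lambda>t. lincomb ys (\<lambda>s. Gam v s t) / (1 + \<bar>t\<bar>)) \<longlongrightarrow> 0) F" for F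
      unfolding * using tendsto_add[OF tendsto_mult_left[OF that(1), of "snd p"] that(2)] by simp
    show ?case using Gam[of "fst p"] Cons L
      by (auto simp: Omega_def intro!: continuous_intros)
  qed (simp add: Omega_def)
  then show ?thesis by (simp add: span_fun_lincomb[abs_def])
qed

text \<open>The list encodes l A(t) + m (A(t) - A(s)). If no multipliers beat L, duality produces a
  combination of two kernel functions that satisfies both constraints with rate at most L, against
  the assumption on the infimum.\<close>

lemma dual_multipliers:
  fixes L :: real
  assumes psd: "\<And>cs. span_inner (Gam v) cs cs \<ge> 0" and v0: "v 0 = 0" and v_cont: "continuous_on {0..} v"
    and v_growth: "\<exists>\<alpha><2. ((\<lambda>t. v t / t powr \<alpha>) \<longlongrightarrow> 0) at_top"
    and b: "b > 0" and c2: "c2 > 0" and st: "0 < s" "s < t"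
    and L: "ereal L < (INF f\<in>Uset b c1 c2 s t. rateI (Gam v) f)"
  shows "\<exists>l\<ge>0. \<exists>m\<ge>0. l * (b + c2 * t) + m * (b + c2 * t - c1 * s)
    - span_inner (Gam v) [(t, l + m), (s, - m)] [(t, l + m), (s, - m)] / 2 > L"
proof (rule ccontr)
  assume contr: "\<not> ?thesis"
  \<comment> \<open>The covariance matrix of (A(t), A(t) - A(s)).\<close>
  define p q r where "p = v t" and "q = v t - Gam v s t" and "r = v (t - s)"
  have r: "r = v t - 2 * Gam v s t + v s" using st by (simp add: r_def Gam_def field_simps)
  have inner: "span_inner (Gam v) [(t, l + m), (s, - m)] [(t, l + m), (s, - m)] = l\<^sup>2 * p + 2 * l * m * q + m\<^sup>2 * r" for l m
    using v0 st Gam_commute[of v t s]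
    by (simp add: span_inner_lincomb Gam_diag p_def q_def r power2_eq_square algebra_simps)
  have inner': "span_inner (Gam v) [(- t, - (l + m)), (- s, m)] [(- t, - (l + m)), (- s, m)] = l\<^sup>2 * p + 2 * l * m * q + m\<^sup>2 * r" for l m
    using v0 st Gam_commute[of v t s]
    by (simp add: span_inner_lincomb Gam_diag Gam_minus p_def q_def r power2_eq_square algebra_simps)
  have "\<exists>l m. l * p + m * q \<ge> b + c2 * t \<and> l * q + m * r \<ge> b + c2 * t - c1 * s \<and> (l\<^sup>2 * p + 2 * l * m * q + m\<^sup>2 * r) / 2 \<le> L"
  proof (rule quadrant_duality)
    show "l\<^sup>2 * p + 2 * l * m * q + m\<^sup>2 * r \<ge> 0" for l m using psd inner by metis
    show "b + c2 * t > 0" using b c2 st by (simp add: add_pos_pos)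
    show "l * (b + c2 * t) + m * (b + c2 * t - c1 * s) - (l\<^sup>2 * p + 2 * l * m * q + m\<^sup>2 * r) / 2 \<le> L"
      if "l \<ge> 0" "m \<ge> 0" for l m
      using contr that unfolding inner by (meson not_le)
  qed
  then obtain l m where lm: "l * p + m * q \<ge> b + c2 * t" "l * q + m * r \<ge> b + c2 * t - c1 * s"
    "(l\<^sup>2 * p + 2 * l * m * q + m\<^sup>2 * r) / 2 \<le> L" by blast
  \<comment> \<open>The candidate path is l times the kernel element of the first constraint plus m
    times that of the second; nodes are negative because \<open>Uset\<close> evaluates paths at -t
    and -s.\<close>
  define ys where "ys = [(- t, - (l + m)), (- s, m)]"
  let ?f = "span_fun (Gam v) ys"
  have "- ?f (- t) = l * p + m * q"
    using v0 st by (simp add: ys_def span_fun_lincomb Gam_diag Gam_minus p_def q_def algebra_simps)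
  moreover have "?f (- s) - ?f (- t) = l * q + m * r"
    using v0 st Gam_commute[of v t s]
    by (simp add: ys_def span_fun_lincomb Gam_diag Gam_minus p_def q_def r algebra_simps)
  ultimately have "?f \<in> Uset b c1 c2 s t"
    using lm span_fun_Omega[OF psd v0 v_cont v_growth] by (simp add: Uset_def)
  then have "(INF f\<in>Uset b c1 c2 s t. rateI (Gam v) f) \<le> rateI (Gam v) ?f"
    by (rule INF_lower)
  also have "\<dots> = ereal (span_inner (Gam v) ys ys / 2)"
    by (rule rateI_span_fun[OF Gam_commute psd])
  also have "\<dots> \<le> ereal L" using lm(3) unfolding ys_def inner' by simp
  finally show False using L by simp
qed

text \<open>Slackening both constraints by the factor \<open>1 - \<epsilon>\<close> costs only a factor \<open>(1 - \<epsilon>)\<^sup>2\<close> in the rate,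
  since the dual objective is homogeneous.\<close>

definition overflow :: "real \<Rightarrow> real \<Rightarrow> real \<Rightarrow> real \<Rightarrow> real \<Rightarrow> real \<Rightarrow> (real \<Rightarrow> real) \<Rightarrow> bool" where
  "overflow b c1 c2 \<epsilon> lo hi x \<longleftrightarrow> (\<exists>t. lo \<le> t \<and> t \<le> hi \<and> x t \<ge> (1 - \<epsilon>) * (b + c2 * t) \<and>
     (\<forall>s. 0 < s \<longrightarrow> s < t \<longrightarrow> x t - x s \<ge> (1 - \<epsilon>) * (b + c2 * t - c1 * s)))"

text \<open>The dual data s, l, m depend on t without any regularity. Near each t they are frozen,
  one Chernoff event at t and one oscillation event cover all nearby crossing times, and a finite
  subcover of [lo, hi] gives C.\<close>

lemma overflow_bound:
  fixes M :: "'a measure"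
  assumes "gaussian_pair M X Y K"
    and dual: "\<And>t. lo \<le> t \<Longrightarrow> t \<le> hi \<Longrightarrow> \<exists>s>0. s < t \<and> (\<exists>l\<ge>0. \<exists>m\<ge>0. l * (b + c2 * t) + m * (b + c2 * t - c1 * s)
        - span_inner K [(t, l + m), (s, - m)] [(t, l + m), (s, - m)] / 2 > L)"
    and \<epsilon>: "0 \<le> \<epsilon>" "\<epsilon> < 1" and L': "L' \<le> (1 - \<epsilon>)\<^sup>2 * L" and lo: "lo > 0"
  shows "\<exists>C. \<forall>n\<ge>1. \<forall>Z. centered_gaussian_process M Z K \<longrightarrow> (\<forall>\<omega>\<in>space M. continuous_on UNIV (Z \<omega>)) \<longrightarrow>
    outer_le M {\<omega> \<in> space M. overflow b c1 c2 \<epsilon> lo hi (\<lambda>t. Z \<omega> t / sqrt (real n))} (C * exp (- (real n * L')))"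
proof -
  interpret gaussian_pair M X Y K by fact
  define R where "R = hi + 1"
  define e where "e = 1 - \<epsilon>"
  have e: "e > 0" using \<epsilon> by (simp add: e_def)
  define near where "near n Z t \<delta> = {\<omega> \<in> space M. \<exists>t'. \<bar>t' - t\<bar> < \<delta> \<and> lo \<le> t' \<and> t' \<le> hi \<and> Z \<omega> t' / sqrt (real n) \<ge> e * (b + c2 * t') \<and>
         (\<forall>s. 0 < s \<longrightarrow> s < t' \<longrightarrow> Z \<omega> t' / sqrt (real n) - Z \<omega> s / sqrt (real n) \<ge> e * (b + c2 * t' - c1 * s))}" for n :: nat and Z :: "'a \<Rightarrow> real \<Rightarrow> real" and t \<delta>
  have local: "\<exists>\<delta>>0. \<forall>n\<ge>1. \<forall>Z. centered_gaussian_process M Z K \<longrightarrow> (\<forall>\<omega>\<in>space M. continuous_on UNIV (Z \<omega>)) \<longrightarrow>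
      outer_le M (near n Z t \<delta>)
        (2 * exp (- (real n * L')))" if t: "lo \<le> t" "t \<le> hi" for t
  proof -
    obtain s l0 m0 where s: "0 < s" "s < t" and lm0: "l0 \<ge> 0" "m0 \<ge> 0" and
      gt: "l0 * (b + c2 * t) + m0 * (b + c2 * t - c1 * s) - span_inner K [(t, l0 + m0), (s, - m0)] [(t, l0 + m0), (s, - m0)] / 2 > L"
      using dual[OF t] by blast
    \<comment> \<open>The thresholds carry one factor e; putting another into the multipliers makes
      the linear terms and the variance all scale by e^2.\<close>
    define l m where "l = e * l0" and "m = e * m0"
    have lm: "l \<ge> 0" "m \<ge> 0" using lm0 e by (auto simp: l_def m_def)
    define cs where "cs = [(t, l + m), (s, - m)]"
    define V where "V = span_inner K cs cs"
    have V: "V = e\<^sup>2 * span_inner K [(t, l0 + m0), (s, - m0)] [(t, l0 + m0), (s, - m0)]"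
      by (simp add: V_def cs_def span_inner_lincomb l_def m_def power2_eq_square algebra_simps)
    define \<phi> where "\<phi> t' = l * (e * (b + c2 * t')) + m * (e * (b + c2 * t' - c1 * s)) - V / 2" for t'
    have "\<phi> t = e\<^sup>2 * (l0 * (b + c2 * t) + m0 * (b + c2 * t - c1 * s) - span_inner K [(t, l0 + m0), (s, - m0)] [(t, l0 + m0), (s, - m0)] / 2)"
      unfolding \<phi>_def V l_def m_def by (simp add: power2_eq_square algebra_simps)
    then have "\<phi> t > e\<^sup>2 * L" using gt e by simp
    then have \<phi>t: "\<phi> t > L'" using L' by (simp add: e_def)
    \<comment> \<open>Half of the gap between \<open>\<phi> t\<close> and L' pays for replacing Z t'
      by Z t, the other half for the variation of \<open>\<phi>\<close>. The summand 1 covers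
      vanishing multipliers.\<close>
    define \<kappa> where "\<kappa> = (\<phi> t - L') / (2 * (l + m + 1))"
    have \<kappa>: "\<kappa> > 0" using \<phi>t lm by (simp add: \<kappa>_def)
    have \<kappa>le: "(l + m) * \<kappa> \<le> (\<phi> t - L') / 2"
    proof -
      have "(l + m) * \<kappa> \<le> (l + m + 1) * \<kappa>" using \<kappa> by (simp add: algebra_simps)
      also have "\<dots> = (\<phi> t - L') / 2"
      proof -
        have "D * (y / (2 * D)) = y / 2" if "D > 0" for D y :: real using that by simp
        from this[of "l + m + 1"] show ?thesis using lm by (simp add: \<kappa>_def del: distrib_left_numeral)
      qed
      finally show ?thesis .
    qed
    have "isCont \<phi> t" unfolding \<phi>_def by (intro continuous_intros)
    then have "eventually (\<lambda>t'. \<phi> t' > (\<phi> t + L') / 2) (at t)"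
      unfolding isCont_def using \<phi>t by (intro order_tendstoD(1)) auto
    then obtain d where d: "d > 0" "\<And>t'. t' \<noteq> t \<Longrightarrow> dist t' t < d \<Longrightarrow> \<phi> t' > (\<phi> t + L') / 2"
      unfolding eventually_at by blast
    have d': "\<phi> t' > (\<phi> t + L') / 2" if "\<bar>t' - t\<bar> < d" for t'
      using d(2)[of t'] \<phi>t that by (cases "t' = t") (auto simp: dist_real_def)
    obtain \<delta>0 where \<delta>0: "\<delta>0 > 0" "\<And>n Z. n \<ge> 1 \<Longrightarrow> centered_gaussian_process M Z K \<Longrightarrow>
      measure M {\<omega> \<in> space M. Z \<omega> \<in> osc_exceeds (rat_pairs R \<delta>0) (sqrt (real n) * \<kappa>)} \<le> exp (- (real n * L'))"
      using modulus_bound[OF \<kappa>, of R L'] by blast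
    \<comment> \<open>The bound t - s keeps s below every nearby crossing time t', so that the
      constraint at s is available.\<close>
    define \<delta> where "\<delta> = min (min \<delta>0 d) (t - s)"
    show ?thesis
    proof (intro exI[of _ \<delta>] conjI allI impI)
      show "\<delta> > 0" using \<delta>0(1) d(1) s by (simp add: \<delta>_def)
      fix n :: nat and Z assume n: "n \<ge> 1" and Z: "centered_gaussian_process M Z K"
        and Zc: "\<forall>\<omega>\<in>space M. continuous_on UNIV (Z \<omega>)"
      let ?S = "near n Z t \<delta>"
      let ?G = "{\<omega> \<in> space M. Z \<omega> \<in> osc_exceeds (rat_pairs R \<delta>0) (sqrt (real n) * \<kappa>)}"
      let ?H = "{\<omega> \<in> space M. lincomb cs (Z \<omega>) \<ge> sqrt (real n) * (L' + V / 2)}"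
      have G: "?G \<in> events" by (intro osc_event Z countable_rat_pairs)
      have [measurable]: "(\<lambda>\<omega>. lincomb cs (Z \<omega>)) \<in> borel_measurable M"
        by (intro lincomb_measurable gaussian_process_measurable[OF Z])
      have H: "?H \<in> events" by measurable
      have "measure M ?H \<le> exp (real n * (V / 2 - (L' + V / 2)))"
        unfolding V_def by (rule chernoff[OF prob_space_axioms Z])
      then have pH: "measure M ?H \<le> exp (- (real n * L'))" by simp
      have "outer_le M ?S (exp (- (real n * L')) + exp (- (real n * L')))"
      proof (rule outer_le_mono[OF outer_le_Un[OF outer_leI[OF G order_refl \<delta>0(2)[OF n Z]] outer_leI[OF H order_refl pH]]])
        show "?S \<subseteq> ?G \<union> ?H"
        proof
          fix \<omega> assume "\<omega> \<in> ?S"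
          then obtain t' where w: "\<omega> \<in> space M" and t': "\<bar>t' - t\<bar> < \<delta>" "lo \<le> t'" "t' \<le> hi"
            and 1: "Z \<omega> t' / sqrt (real n) \<ge> e * (b + c2 * t')"
            and 2: "\<And>s. 0 < s \<Longrightarrow> s < t' \<Longrightarrow> Z \<omega> t' / sqrt (real n) - Z \<omega> s / sqrt (real n) \<ge> e * (b + c2 * t' - c1 * s)"
            unfolding near_def by blast
          have n0: "sqrt (real n) > 0" using n by simp
          show "\<omega> \<in> ?G \<union> ?H"
          proof (cases "\<bar>Z \<omega> t' - Z \<omega> t\<bar> > sqrt (real n) * \<kappa>")
            case True
            have "continuous_on UNIV (Z \<omega>)" using Zc w by blast
            then have "Z \<omega> \<in> osc_exceeds (rat_pairs R \<delta>0) (sqrt (real n) * \<kappa>)"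
              using t t' lo True by (intro osc_exceeds_rat_pairs[of _ t' _ t]) (auto simp: R_def \<delta>_def)
            then show ?thesis using w by blast
          next
            case False
            define x where "x u = Z \<omega> u / sqrt (real n)" for u
            have "s < t'" using t'(1) by (auto simp: \<delta>_def)
            note 1 = 1[folded x_def] and 2 = 2[OF s(1) this, folded x_def]
            have "Z \<omega> t' - Z \<omega> t \<le> sqrt (real n) * \<kappa>" using False by linarith
            then have "(Z \<omega> t' - Z \<omega> t) / sqrt (real n) \<le> \<kappa>" using n0 by (simp add: divide_le_eq mult.commute)
            then have x3: "x t' - \<kappa> \<le> x t" by (simp add: x_def diff_divide_distrib)
            have "l * (e * (b + c2 * t')) + m * (e * (b + c2 * t' - c1 * s)) \<le> l * x t' + m * (x t' - x s)"
              using 1 2 lm by (intro add_mono mult_left_mono) auto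
            also have "\<dots> \<le> l * (x t + \<kappa>) + m * (x t + \<kappa> - x s)"
              using x3 lm by (intro add_mono mult_left_mono) auto
            also have "\<dots> = (l + m) * x t - m * x s + (l + m) * \<kappa>" by (simp add: algebra_simps)
            finally have "\<phi> t' + V / 2 \<le> (l + m) * x t - m * x s + (l + m) * \<kappa>" by (simp add: \<phi>_def)
            moreover have "\<phi> t' > (\<phi> t + L') / 2" using d' t'(1) by (simp add: \<delta>_def)
            moreover have "(\<phi> t + L') / 2 - (\<phi> t - L') / 2 = L'" by (simp add: field_simps)
            ultimately have "L' + V / 2 \<le> (l + m) * x t - m * x s" using \<kappa>le by linarith
            then have "sqrt (real n) * (L' + V / 2) \<le> sqrt (real n) * ((l + m) * x t - m * x s)"
              using n0 by (intro mult_left_mono) auto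
            also have "\<dots> = (l + m) * (sqrt (real n) * x t) - m * (sqrt (real n) * x s)" by (simp add: algebra_simps)
            also have "\<dots> = lincomb cs (Z \<omega>)" using n0 by (simp add: cs_def x_def)
            finally show ?thesis using w by blast
          qed
        qed
      qed simp
      then show "outer_le M ?S (2 * exp (- (real n * L')))" by simp
    qed
  qed
  then have "\<exists>\<delta>. \<forall>t\<in>{lo..hi}. \<delta> t > 0 \<and> (\<forall>n\<ge>1. \<forall>Z. centered_gaussian_process M Z K \<longrightarrow>
      (\<forall>\<omega>\<in>space M. continuous_on UNIV (Z \<omega>)) \<longrightarrow> outer_le M (near n Z t (\<delta> t)) (2 * exp (- (real n * L'))))"
    by (intro bchoice) auto
  then obtain \<delta> where \<delta>: "\<And>t. t \<in> {lo..hi} \<Longrightarrow> \<delta> t > 0" and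
    \<delta>': "\<And>t n Z. t \<in> {lo..hi} \<Longrightarrow> n \<ge> 1 \<Longrightarrow> centered_gaussian_process M Z K \<Longrightarrow> (\<forall>\<omega>\<in>space M. continuous_on UNIV (Z \<omega>)) \<Longrightarrow>
      outer_le M (near n Z t (\<delta> t)) (2 * exp (- (real n * L')))"
    by blast
  have "{lo..hi} \<subseteq> (\<Union>t\<in>{lo..hi}. ball t (\<delta> t))" using \<delta> by fastforce
  then obtain F where F: "F \<subseteq> {lo..hi}" "finite F" "{lo..hi} \<subseteq> (\<Union>t\<in>F. ball t (\<delta> t))"
    using compactE_image[of "{lo..hi}" "{lo..hi}" "\<lambda>t. ball t (\<delta> t)"] by auto
  show ?thesis
  proof (intro exI[of _ "real (card F) * 2"] allI impI)
    fix n :: nat and Z assume n: "n \<ge> 1" and Z: "centered_gaussian_process M Z K"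
      and Zc: "\<forall>\<omega>\<in>space M. continuous_on UNIV (Z \<omega>)"
    have "outer_le M (\<Union>t\<in>F. near n Z t (\<delta> t))
        (real (card F) * (2 * exp (- (real n * L'))))"
      using F(1) by (intro outer_le_UN F(2) \<delta>' n Z Zc) auto
    then show "outer_le M {\<omega> \<in> space M. overflow b c1 c2 \<epsilon> lo hi (\<lambda>t. Z \<omega> t / sqrt (real n))}
        (real (card F) * 2 * exp (- (real n * L')))"
    proof (rule outer_le_mono)
      show "{\<omega> \<in> space M. overflow b c1 c2 \<epsilon> lo hi (\<lambda>t. Z \<omega> t / sqrt (real n))} \<subseteq>
        (\<Union>t\<in>F. near n Z t (\<delta> t))"
      proof
        fix \<omega> assume "\<omega> \<in> {\<omega> \<in> space M. overflow b c1 c2 \<epsilon> lo hi (\<lambda>t. Z \<omega> t / sqrt (real n))}"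
        then obtain t' where w: "\<omega> \<in> space M" and t': "lo \<le> t'" "t' \<le> hi" "Z \<omega> t' / sqrt (real n) \<ge> e * (b + c2 * t')"
          "\<forall>s. 0 < s \<longrightarrow> s < t' \<longrightarrow> Z \<omega> t' / sqrt (real n) - Z \<omega> s / sqrt (real n) \<ge> e * (b + c2 * t' - c1 * s)"
          unfolding overflow_def e_def by blast
        have "t' \<in> {lo..hi}" using t' by simp
        then have "t' \<in> (\<Union>t\<in>F. ball t (\<delta> t))" using F(3) by blast
        then obtain t where "t \<in> F" "\<bar>t' - t\<bar> < \<delta> t" by (auto simp: dist_real_def abs_minus_commute)
        then show "\<omega> \<in> (\<Union>t\<in>F. near n Z t (\<delta> t))"
          unfolding near_def using w t' by blast
      qed
    qed simp
  qed
qed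

section \<open>Averages of independent copies and crossing times\<close>

lemma gaussian_process_sum:
  assumes "prob_space M" and A: "\<And>i. centered_gaussian_process M (A i) K"
    and indep: "prob_space.indep_vars M (\<lambda>_. paths) A UNIV"
  shows "centered_gaussian_process M (\<lambda>\<omega> t. \<Sum>i<n. A i \<omega> t) (\<lambda>s t. real n * K s t)"
  unfolding centered_gaussian_process_iff
proof (intro conjI allI)
  interpret prob_space M by fact
  fix t show "(\<lambda>\<omega>. \<Sum>i<n. A i \<omega> t) \<in> borel_measurable M"
    by (intro borel_measurable_sum gaussian_process_measurable[OF A])
next
  interpret prob_space M by fact
  fix cs :: "(real \<times> real) list"
  have [measurable]: "(\<lambda>\<omega>. lincomb cs (A i \<omega>)) \<in> borel_measurable M" for i
    by (intro lincomb_measurable gaussian_process_measurable[OF A])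
  have "lincomb cs \<in> borel_measurable paths"
    by (rule lincomb_measurable) simp
  then have "indep_vars (\<lambda>_. borel) (\<lambda>i \<omega>. lincomb cs (A i \<omega>)) UNIV"
    by (intro indep_vars_compose2[OF indep])
  then have ind: "indep_vars (\<lambda>_. borel) (\<lambda>i \<omega>. lincomb cs (A i \<omega>)) {..<n}"
    by (rule indep_vars_subset) simp
  have "(CLINT \<omega>|M. iexp (lincomb cs (\<lambda>t. \<Sum>i<n. A i \<omega> t))) = char (distr M borel (\<lambda>\<omega>. \<Sum>i<n. lincomb cs (A i \<omega>))) 1"
    by (simp add: char_def integral_distr lincomb_sum)
  also have "\<dots> = (\<Prod>i<n. char (distr M borel (\<lambda>\<omega>. lincomb cs (A i \<omega>))) 1)"
    by (rule char_distr_sum[OF ind])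
  also have "\<dots> = (\<Prod>i<n. CLINT \<omega>|M. iexp (lincomb cs (A i \<omega>)))"
    by (simp add: char_def integral_distr)
  also have "\<dots> = of_real (exp (- span_inner K cs cs / 2)) ^ n"
    using A by (simp add: centered_gaussian_process_iff)
  also have "\<dots> = of_real (exp (- (real n * span_inner K cs cs) / 2))"
    by (simp add: of_real_power[symmetric] exp_of_nat_mult[symmetric] del: of_real_power of_real_exp)
  also have "real n * span_inner K cs cs = span_inner (\<lambda>s t. real n * K s t) cs cs"
    by (simp add: span_inner_lincomb lincomb_mult)
  finally show "(CLINT \<omega>|M. iexp (lincomb cs (\<lambda>t. \<Sum>i<n. A i \<omega> t))) =
      of_real (exp (- span_inner (\<lambda>s t. real n * K s t) cs cs / 2))" .
qed

text \<open>The two factors 1 / sqrt n cancel the n in the covariance of the sum, and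
  \<open>Gam\<close> is invariant under reflecting both times, so the law does not depend on
  n.\<close>

lemma gaussian_process_reversed_average:
  assumes "prob_space M" and A: "\<And>i. centered_gaussian_process M (A i) (Gam v)"
    and indep: "prob_space.indep_vars M (\<lambda>_. paths) A UNIV" and n: "n \<ge> 1"
  shows "centered_gaussian_process M (\<lambda>\<omega> t. - (\<Sum>i<n. A i \<omega> (- t)) / sqrt (real n)) (Gam v)"
proof -
  have "centered_gaussian_process M (\<lambda>\<omega> t. lincomb [(- t, - 1 / sqrt (real n))] (\<lambda>t. \<Sum>i<n. A i \<omega> t)) (Gam v)"
  proof (rule gaussian_process_linear_image[OF gaussian_process_sum[OF assms(1) A indep]])
    show "Gam v t w = span_inner (\<lambda>s t. real n * Gam v s t) [(- t, - 1 / sqrt (real n))] [(- w, - 1 / sqrt (real n))]" for t w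
      using n by (simp add: span_inner_lincomb Gam_minus)
  qed
  then show ?thesis by simp
qed

lemma indep_vars_pair:
  assumes "prob_space M" "prob_space.indep_vars M (\<lambda>_. N) A UNIV" "i \<noteq> j"
  shows "prob_space.indep_var M N (A i) N (A j)"
proof -
  interpret prob_space M by fact
  have "indep_var N ((\<lambda>f. f i) \<circ> (\<lambda>\<omega>. restrict (\<lambda>k. A k \<omega>) {i})) N ((\<lambda>f. f j) \<circ> (\<lambda>\<omega>. restrict (\<lambda>k. A k \<omega>) {j}))"
    using assms(3) by (intro indep_var_compose[OF indep_var_restrict[OF assms(2)]]) auto
  then show ?thesis by (simp add: comp_def)
qed

section \<open>From the two suprema to a crossing time\<close>

lemma bdd_above_drift:
  fixes x :: "real \<Rightarrow> real"
  assumes x: "continuous_on UNIV x" and N: "\<And>t. t \<ge> N \<Longrightarrow> x t \<le> c * t"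
  shows "bdd_above ((\<lambda>t. x t - c * t) ` {0<..})"
proof -
  have "continuous_on {0..N} (\<lambda>t. x t - c * t)"
    by (intro continuous_intros continuous_on_subset[OF x]) auto
  then have "bdd_above ((\<lambda>t. x t - c * t) ` {0..N})"
    by (intro bounded_imp_bdd_above compact_imp_bounded compact_continuous_image) auto
  then obtain B where B: "\<And>t. t \<in> {0..N} \<Longrightarrow> x t - c * t \<le> B"
    unfolding bdd_above_def by blast
  show ?thesis
  proof (rule bdd_aboveI2)
    fix t :: real assume t: "t \<in> {0<..}"
    show "x t - c * t \<le> max 0 B"
    proof (cases "t \<ge> N")
      case True
      then show ?thesis using N[OF True] by simp
    next
      case False
      then show ?thesis using B[of t] t by simp
    qed
  qed
qed

text \<open>One t beats the second supremum by b, hence beats every s at once. The choice s = t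
  forces t beyond b / (c1 - c2), and s tending to 0 gives the single-time constraint.\<close>

lemma sup_difference_exceeds:
  fixes x :: "real \<Rightarrow> real"
  assumes x: "continuous_on UNIV x" "x 0 = 0" and N: "\<And>t. t \<ge> N \<Longrightarrow> x t \<le> c2 * t" "N \<ge> 0"
    and c: "c2 > 0" "c1 > c2" and b: "b > 0"
    and Q: "(SUP t\<in>{0<..}. x t - c2 * t) - (SUP s\<in>{0<..}. x s - c1 * s) > b"
  shows "\<exists>t>b / (c1 - c2). t \<le> N \<and> x t \<ge> b + c2 * t \<and> (\<forall>s>0. x t - x s \<ge> b + c2 * t - c1 * s)"
proof -
  let ?U = "SUP s\<in>{0<..}. x s - c1 * s"
  have "x t \<le> c1 * t" if "t \<ge> N" for t
  proof -
    have "x t \<le> c2 * t" by (rule N(1)[OF that])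
    also have "\<dots> \<le> c1 * t" using that N(2) c by (intro mult_right_mono) auto
    finally show ?thesis .
  qed
  then have "bdd_above ((\<lambda>s. x s - c1 * s) ` {0<..})" by (rule bdd_above_drift[OF x(1)])
  then have U: "x s - c1 * s \<le> ?U" if "s > 0" for s using that by (intro cSUP_upper) auto
  have "b + ?U < (SUP t\<in>{0<..}. x t - c2 * t)" using Q by simp
  then obtain t where t: "t > 0" "b + ?U < x t - c2 * t"
    using bdd_above_drift[OF x(1) N(1)] by (subst (asm) less_cSUP_iff) auto
  have less: "b + (x s - c1 * s) < x t - c2 * t" if "s > 0" for s using U[OF that] t by linarith
  have "(c1 - c2) * t > b" using less[OF t(1)] by (simp add: algebra_simps)
  then have "t > b / (c1 - c2)" using c by (simp add: field_simps)
  moreover have xt: "x t \<ge> b + c2 * t"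
  proof -
    \<comment> \<open>The second supremum runs over s > 0 only, so the value at s = 0 is reached as
      a limit, through continuity and x 0 = 0.\<close>
    have "((\<lambda>s. b + (x s - c1 * s)) \<longlongrightarrow> b + (x 0 - c1 * 0)) (at_right 0)"
      using x(1) by (intro tendsto_intros) (auto simp: continuous_on_def intro: tendsto_within_subset)
    moreover have "eventually (\<lambda>s. b + (x s - c1 * s) \<le> x t - c2 * t) (at_right 0)"
      using less by (auto simp: eventually_at_filter intro!: always_eventually less_imp_le)
    ultimately have "b + (x 0 - c1 * 0) \<le> x t - c2 * t"
      by (rule tendsto_upperbound) simp
    then show ?thesis using x(2) by simp
  qed
  moreover have "t \<le> N"
  proof (rule ccontr)
    assume "\<not> t \<le> N"
    then have "x t \<le> c2 * t" using N(1) by simp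
    then show False using xt b by simp
  qed
  moreover have "x t - x s \<ge> b + c2 * t - c1 * s" if "s > 0" for s using less[OF that] by linarith
  ultimately show ?thesis by blast
qed

text \<open>The rate is only lower semicontinuous at \<open>b / (c1 - c2)\<close>, so that crossing times close to this
  boundary cannot be handled by compactness. Delaying the path by \<open>\<eta>\<close> keeps its law and moves the
  crossing time away from the boundary, at the price of slackening the constraints.\<close>

lemma overflow_cases:
  fixes x :: "real \<Rightarrow> real" and b c1 c2 :: real
  defines "t0 \<equiv> b / (c1 - c2)"
  assumes b: "b > 0" and c: "c2 > 0" "c1 > c2" and \<epsilon>: "0 < \<epsilon>" "\<epsilon> \<le> 1 / 2" and \<eta>: "\<eta> > 0" "c1 * \<eta> \<le> \<epsilon> * b / 4"
    and t: "t > t0" "t \<le> N" and x0: "x 0 = 0" and xt: "x t \<ge> b + c2 * t" and xs: "\<And>s. s > 0 \<Longrightarrow> x t - x s \<ge> b + c2 * t - c1 * s"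
    and small: "\<And>u. - \<eta> \<le> u \<Longrightarrow> u \<le> 0 \<Longrightarrow> \<bar>x u\<bar> \<le> \<epsilon> * b / 4"
  shows "overflow b c1 c2 0 (t0 + \<eta>) N x \<or> overflow b c1 c2 \<epsilon> (t0 + \<eta>) (t0 + 2 * \<eta>) (\<lambda>u. x (u - \<eta>) - x (- \<eta>))"
proof (cases "t \<ge> t0 + \<eta>")
  case True
  then have "overflow b c1 c2 0 (t0 + \<eta>) N x"
    unfolding overflow_def using t xt xs by (intro exI[of _ t]) auto
  then show ?thesis ..
next
  case False
  have t0: "(c1 - c2) * t0 = b" using c by (simp add: t0_def)
  have t0_pos: "t0 > 0" using b c by (simp add: t0_def)
  have c2\<eta>: "c2 * \<eta> \<le> \<epsilon> * b / 4" using \<eta> c mult_right_mono[of c2 c1 \<eta>] by linarith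
  define t' where "t' = t + \<eta>"
  \<comment> \<open>After the delay, s = \<open>\<eta>\<close> corresponds to the original time 0,
    so the constraint is needed there too; it is the single-time constraint.\<close>
  have xs0: "x t - x s \<ge> b + c2 * t - c1 * s" if "s \<ge> 0" for s
    using xs[of s] xt x0 that by (cases "s = 0") auto
  have "overflow b c1 c2 \<epsilon> (t0 + \<eta>) (t0 + 2 * \<eta>) (\<lambda>u. x (u - \<eta>) - x (- \<eta>))"
    unfolding overflow_def
  proof (intro exI[of _ t'] conjI allI impI)
    show "t0 + \<eta> \<le> t'" "t' \<le> t0 + 2 * \<eta>" using t False by (auto simp: t'_def)
    have bt: "b \<le> b + c2 * t'" using c t t0_pos \<eta> by (simp add: t'_def)
    then have "\<epsilon> * b \<le> \<epsilon> * (b + c2 * t')" using \<epsilon> by (intro mult_left_mono) auto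
    moreover have "\<epsilon> * b > 0" using \<epsilon> b by simp
    moreover have "b + c2 * t = b + c2 * t' - c2 * \<eta>" by (simp add: t'_def algebra_simps)
    moreover have "x t - x (- \<eta>) \<ge> b + c2 * t - \<epsilon> * b / 4" using xt small[of "- \<eta>"] \<eta> by simp
    moreover have "(1 - \<epsilon>) * (b + c2 * t') = (b + c2 * t') - \<epsilon> * (b + c2 * t')" by (simp add: left_diff_distrib)
    ultimately have "x t - x (- \<eta>) \<ge> (1 - \<epsilon>) * (b + c2 * t')" using c2\<eta> by linarith
    then show "x (t' - \<eta>) - x (- \<eta>) \<ge> (1 - \<epsilon>) * (b + c2 * t')" by (simp add: t'_def)
  next
    fix s assume s: "0 < s" "s < t'"
    define y where "y = b + c2 * t' - c1 * s"
    have y: "(1 - \<epsilon>) * y = y - \<epsilon> * y" by (simp add: left_diff_distrib)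
    have "x t - x (s - \<eta>) \<ge> (1 - \<epsilon>) * y"
    proof (cases "s \<ge> \<eta>")
      case True
      have "x t - x (s - \<eta>) \<ge> b + c2 * t - c1 * (s - \<eta>)" using True by (intro xs0) simp
      also have "b + c2 * t - c1 * (s - \<eta>) = y + (c1 - c2) * \<eta>" by (simp add: y_def t'_def algebra_simps)
      finally have 1: "x t - x (s - \<eta>) \<ge> y + (c1 - c2) * \<eta>" .
      \<comment> \<open>For s near t' the right-hand side y may be negative, but only by 2 (c1 - c2)
        \<open>\<eta>\<close>. With \<open>\<epsilon> \<le> 1 / 2\<close>, the gain (c1 - c2)
        \<open>\<eta>\<close> from the delay makes up for the loss.\<close>
      have "c1 * s \<le> c1 * t'" using s c by (intro mult_left_mono) auto
      then have "y \<ge> (c1 - c2) * t0 - (c1 - c2) * t'" unfolding t0 y_def by (simp add: algebra_simps)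
      moreover have "(c1 - c2) * t' \<le> (c1 - c2) * (t0 + 2 * \<eta>)"
        using False c by (intro mult_left_mono) (auto simp: t'_def)
      ultimately have y2: "y \<ge> - 2 * ((c1 - c2) * \<eta>)" by (simp add: algebra_simps)
      have "\<epsilon> * y \<ge> - ((c1 - c2) * \<eta>)"
      proof (cases "y \<ge> 0")
        case True
        have "0 \<le> \<epsilon> * y" using True \<epsilon> by simp
        moreover have "0 \<le> (c1 - c2) * \<eta>" using c \<eta> by simp
        ultimately show ?thesis by linarith
      next
        case False
        then have "\<epsilon> * y \<ge> 1 / 2 * y" using \<epsilon> by (intro mult_right_mono_neg) auto
        then show ?thesis using y2 by linarith
      qed
      then show ?thesis using 1 y by linarith
    next
      case False
      \<comment> \<open>Here x is evaluated at a negative time, where it is merely small. This and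
        the shift of c2 t lose \<open>\<epsilon> * b / 4\<close> each, together at most
        \<open>\<epsilon> * y\<close> because \<open>y \<ge> b / 2\<close>.\<close>
      have "\<bar>x (s - \<eta>)\<bar> \<le> \<epsilon> * b / 4" using False s by (intro small) auto
      then have 1: "x t - x (s - \<eta>) \<ge> b + c2 * t - \<epsilon> * b / 4" using xt by linarith
      have cs: "0 \<le> c1 * s" using c s by simp
      have "c1 * s \<le> c1 * \<eta>" using False c by (intro mult_left_mono) auto
      moreover have "\<epsilon> * b \<le> 1 / 2 * b" using \<epsilon> b by (intro mult_right_mono) auto
      moreover have "c2 * t' \<ge> 0" using c t t0_pos \<eta> by (simp add: t'_def)
      ultimately have "y \<ge> b / 2" using \<eta>(2) b unfolding y_def by linarith
      then have "\<epsilon> * y \<ge> \<epsilon> * (b / 2)" using \<epsilon> by (intro mult_left_mono) auto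
      moreover have "b + c2 * t = y - c2 * \<eta> + c1 * s" by (simp add: y_def t'_def algebra_simps)
      ultimately show ?thesis using 1 c2\<eta> cs y by (simp add: field_simps)
    qed
    then show "x (t' - \<eta>) - x (- \<eta>) - (x (s - \<eta>) - x (- \<eta>)) \<ge> (1 - \<epsilon>) * (b + c2 * t' - c1 * s)"
      by (simp add: t'_def y_def)
  qed
  then show ?thesis ..
qed

section \<open>Assembling the exponential bound\<close>

lemma limsup_elog_le:
  assumes p: "\<And>n. n \<ge> 1 \<Longrightarrow> p n \<le> C * exp (- (real n * L))"
  shows "limsup (\<lambda>n. elog (p n) / ereal (real n)) \<le> ereal (- L)"
proof -
  \<comment> \<open>The maximum keeps the logarithm of the constant well behaved; its contribution
    ln D / n vanishes in the limit.\<close>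
  define D where "D = max 1 C"
  have "eventually (\<lambda>n. elog (p n) / ereal (real n) \<le> ereal (ln D / real n - L)) sequentially"
    using eventually_ge_at_top[of 1]
  proof eventually_elim
    case (elim n)
    show ?case
    proof (cases "p n \<le> 0")
      case True
      then show ?thesis using elim by (simp add: elog_def)
    next
      case False
      have "p n \<le> D * exp (- (real n * L))"
        using p[OF elim] by (rule order_trans) (simp add: D_def)
      then have "ln (p n) \<le> ln (D * exp (- (real n * L)))" using False by (intro ln_mono) auto
      also have "\<dots> = ln D - real n * L" by (subst ln_mult) (auto simp: D_def)
      finally have "ln (p n) / real n \<le> (ln D - real n * L) / real n" by (rule divide_right_mono) simp
      also have "\<dots> = ln D / real n - L" using elim by (simp add: diff_divide_distrib)
      finally show ?thesis using False elim by (simp add: elog_def)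
    qed
  qed
  then have "limsup (\<lambda>n. elog (p n) / ereal (real n)) \<le> limsup (\<lambda>n. ereal (ln D / real n - L))"
    by (rule Limsup_mono)
  also have "(\<lambda>n. ln D / real n - L) \<longlonglongrightarrow> - L" by real_asymp
  then have "limsup (\<lambda>n. ereal (ln D / real n - L)) = ereal (- L)"
    by (intro lim_imp_Limsup) auto
  finally show ?thesis .
qed


lemma overflow_probability_bound:
  fixes M :: "'a measure" and A :: "nat \<Rightarrow> 'a \<Rightarrow> real \<Rightarrow> real" and L' :: real
  assumes M: "prob_space M"
    and v_cont: "continuous_on {0..} v" and v0: "v 0 = 0"
    and v_growth: "\<exists>\<alpha><2. ((\<lambda>t. v t / t powr \<alpha>) \<longlongrightarrow> 0) at_top"
    and A: "\<And>i. centered_gaussian_process M (A i) (Gam v)"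
    and A_cont: "\<And>i \<omega>. \<omega> \<in> space M \<Longrightarrow> continuous_on UNIV (A i \<omega>)"
    and A_zero: "\<And>i \<omega>. \<omega> \<in> space M \<Longrightarrow> A i \<omega> 0 = 0"
    and A_indep: "prob_space.indep_vars M (\<lambda>_. paths) A UNIV"
    and b: "b > 0" and c2: "c2 > 0" and c12: "c1 > c2"
    and L': "ereal L' < (INF t\<in>{b / (c1 - c2)<..}. SUP s\<in>{0<..<t}. INF f\<in>Uset b c1 c2 s t. rateI (Gam v) f)"
  shows "\<exists>C. \<forall>n\<ge>1. measure M {\<omega> \<in> space M. Q2 A c1 c2 n \<omega> > real n * b} \<le> C * exp (- (real n * L'))"
proof (cases "L' \<le> 0")
  case True
  interpret prob_space M by fact
  \<comment> \<open>For a nonpositive rate the bound exceeds 1. Positivity of L' is used in the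
    other case, where a factor slightly below 1 must lower the rate.\<close>
  have "measure M {\<omega> \<in> space M. Q2 A c1 c2 n \<omega> > real n * b} \<le> 1 * exp (- (real n * L'))" for n
  proof -
    have "measure M {\<omega> \<in> space M. Q2 A c1 c2 n \<omega> > real n * b} \<le> 1" by (rule prob_le_1)
    also have "1 \<le> exp (- (real n * L'))" using True by (simp add: mult_nonneg_nonpos)
    finally show ?thesis by simp
  qed
  then show ?thesis by blast
next
  case False
  then have L'0: "L' > 0" by simp
  interpret prob_space M by fact
  have gp: "gaussian_pair M (A 0) (A 1) (Gam v)"
    by unfold_locales (auto intro: A A_cont indep_vars_pair[OF M A_indep])
  have psd: "span_inner (Gam v) cs cs \<ge> 0" for cs by (rule gaussian_psd[OF M A])
  define t0 where "t0 = b / (c1 - c2)"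
  have t0: "t0 > 0" using b c12 by (simp add: t0_def)
  \<comment> \<open>The room between L' and L pays for the slack \<open>\<epsilon>\<close>; L is
    real even if the infimum is infinite.\<close>
  obtain L where L: "ereal L' < ereal L" "ereal L < (INF t\<in>{t0<..}. SUP s\<in>{0<..<t}. INF f\<in>Uset b c1 c2 s t. rateI (Gam v) f)"
    using ereal_dense2[OF L'] unfolding t0_def by blast
  have LL: "L' < L" using L(1) by simp
  have dual: "\<exists>s>0. s < t \<and> (\<exists>l\<ge>0. \<exists>m\<ge>0. l * (b + c2 * t) + m * (b + c2 * t - c1 * s)
        - span_inner (Gam v) [(t, l + m), (s, - m)] [(t, l + m), (s, - m)] / 2 > L)" if "t > t0" for t
  proof -
    have "ereal L < (SUP s\<in>{0<..<t}. INF f\<in>Uset b c1 c2 s t. rateI (Gam v) f)"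
      using less_INF_D[OF L(2)] that by auto
    then obtain s where "0 < s" "s < t" "ereal L < (INF f\<in>Uset b c1 c2 s t. rateI (Gam v) f)"
      unfolding less_SUP_iff by auto
    then show ?thesis using dual_multipliers[OF psd v0 v_cont v_growth b c2] by blast
  qed
  \<comment> \<open>Since (1 - \<open>\<epsilon>\<close>)^2 is at least 1 - 2
    \<open>\<epsilon>\<close>, the slack costs at most 2 \<open>\<epsilon>\<close> L, which this
    choice keeps within L - L'.\<close>
  define \<epsilon> where "\<epsilon> = min (1 / 2) ((L - L') / (2 * L))"
  have \<epsilon>: "0 < \<epsilon>" "\<epsilon> \<le> 1 / 2" using LL L'0 by (auto simp: \<epsilon>_def)
  have \<epsilon>L: "L' \<le> (1 - \<epsilon>)\<^sup>2 * L"
  proof -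
    have "\<epsilon> * (2 * L) \<le> L - L'" using LL L'0 by (simp add: \<epsilon>_def min_def field_simps)
    then have "L' \<le> (1 - 2 * \<epsilon>) * L" by (simp add: algebra_simps)
    also have "\<dots> \<le> (1 - \<epsilon>)\<^sup>2 * L"
      using LL L'0 by (intro mult_right_mono) (auto simp: power2_eq_square algebra_simps)
    finally show ?thesis .
  qed
  define \<kappa> where "\<kappa> = \<epsilon> * b / 4"
  have \<kappa>: "\<kappa> > 0" using \<epsilon> b by (simp add: \<kappa>_def)
  obtain \<delta> where \<delta>: "\<delta> > 0" "\<And>n Z. n \<ge> 1 \<Longrightarrow> centered_gaussian_process M Z (Gam v) \<Longrightarrow>
    measure M {\<omega> \<in> space M. Z \<omega> \<in> osc_exceeds (rat_pairs 1 \<delta>) (sqrt (real n) * \<kappa>)} \<le> exp (- (real n * L'))"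
    using gaussian_pair.modulus_bound[OF gp \<kappa>, of 1 L'] by blast
  \<comment> \<open>The first two terms put [-\<open>\<eta>\<close>, 0] inside the window of the
    modulus bound, and the third gives c1 \<open>\<eta> \<le> \<kappa>\<close>, as
    \<open>overflow_cases\<close> requires.\<close>
  define \<eta> where "\<eta> = min (min (\<delta> / 2) (1 / 2)) (\<kappa> / c1)"
  have \<eta>: "\<eta> > 0" "\<eta> < \<delta>" "\<eta> < 1" using \<delta>(1) \<kappa> c2 c12 by (auto simp: \<eta>_def)
  have \<eta>c: "c1 * \<eta> \<le> \<epsilon> * b / 4"
  proof -
    have "c1 * \<eta> \<le> c1 * (\<kappa> / c1)" using c2 c12 by (intro mult_left_mono) (auto simp: \<eta>_def)
    then show ?thesis using c2 c12 by (simp add: \<kappa>_def)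
  qed
  obtain C1 N where C1: "\<And>n Z. n \<ge> 1 \<Longrightarrow> centered_gaussian_process M Z (Gam v) \<Longrightarrow>
    (\<forall>\<omega>\<in>space M. continuous_on UNIV (Z \<omega>)) \<Longrightarrow>
    outer_le M {\<omega> \<in> space M. \<exists>t\<ge>real N. Z \<omega> t > sqrt (real n) * (c2 * t)} (C1 * exp (- (real n * L')))"
    using linear_growth_tail[OF gp v0 v_growth c2, of L'] by blast
  have "\<exists>C. \<forall>n\<ge>1. \<forall>Z. centered_gaussian_process M Z (Gam v) \<longrightarrow> (\<forall>\<omega>\<in>space M. continuous_on UNIV (Z \<omega>)) \<longrightarrow>
    outer_le M {\<omega> \<in> space M. overflow b c1 c2 0 (t0 + \<eta>) (real N) (\<lambda>t. Z \<omega> t / sqrt (real n))} (C * exp (- (real n * L')))"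
    using t0 \<eta> LL by (intro overflow_bound[OF gp dual]) auto
  then obtain C2 where C2: "\<And>n Z. n \<ge> 1 \<Longrightarrow> centered_gaussian_process M Z (Gam v) \<Longrightarrow> (\<forall>\<omega>\<in>space M. continuous_on UNIV (Z \<omega>)) \<Longrightarrow>
    outer_le M {\<omega> \<in> space M. overflow b c1 c2 0 (t0 + \<eta>) (real N) (\<lambda>t. Z \<omega> t / sqrt (real n))} (C2 * exp (- (real n * L')))"
    by blast
  have "\<exists>C. \<forall>n\<ge>1. \<forall>Z. centered_gaussian_process M Z (Gam v) \<longrightarrow> (\<forall>\<omega>\<in>space M. continuous_on UNIV (Z \<omega>)) \<longrightarrow>
    outer_le M {\<omega> \<in> space M. overflow b c1 c2 \<epsilon> (t0 + \<eta>) (t0 + 2 * \<eta>) (\<lambda>t. Z \<omega> t / sqrt (real n))} (C * exp (- (real n * L')))"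
    using t0 \<eta> \<epsilon> \<epsilon>L by (intro overflow_bound[OF gp dual]) auto
  then obtain C3 where C3: "\<And>n Z. n \<ge> 1 \<Longrightarrow> centered_gaussian_process M Z (Gam v) \<Longrightarrow> (\<forall>\<omega>\<in>space M. continuous_on UNIV (Z \<omega>)) \<Longrightarrow>
    outer_le M {\<omega> \<in> space M. overflow b c1 c2 \<epsilon> (t0 + \<eta>) (t0 + 2 * \<eta>) (\<lambda>t. Z \<omega> t / sqrt (real n))} (C3 * exp (- (real n * L')))"
    by blast
  show ?thesis
  proof (intro exI[of _ "C1 + C2 + C3 + 1"] allI impI)
    fix n :: nat assume n: "n \<ge> 1"
    define r where "r = sqrt (real n)"
    have r: "r > 0" "r * r = real n" using n by (auto simp: r_def)
    define Z where "Z \<omega> t = - (\<Sum>i<n. A i \<omega> (- t)) / sqrt (real n)" for \<omega> t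
    \<comment> \<open>The path delayed by \<open>\<eta>\<close> and recentred at 0: by stationary
      increments it has the same covariance, so \<open>C3\<close> applies to it.\<close>
    define W where "W \<omega> u = Z \<omega> (u + - \<eta>) - Z \<omega> (- \<eta>)" for \<omega> u
    have Z: "centered_gaussian_process M Z (Gam v)"
      unfolding Z_def using A A_indep n by (intro gaussian_process_reversed_average[OF M]) auto
    have W: "centered_gaussian_process M W (Gam v)"
      unfolding W_def by (rule gaussian_process_shift[OF Z v0])
    have Zc: "continuous_on UNIV (Z \<omega>)" if "\<omega> \<in> space M" for \<omega>
    proof -
      have "continuous_on UNIV (\<lambda>t. A i \<omega> (- t))" for i
        by (rule continuous_on_compose2[OF A_cont[OF that]]) (auto intro!: continuous_intros)
      then have "continuous_on UNIV (\<lambda>t. - (\<Sum>i<n. A i \<omega> (- t)) / sqrt (real n))"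
        using n by (intro continuous_on_divide continuous_on_minus continuous_on_sum continuous_on_const) auto
      then show ?thesis by (simp add: Z_def[abs_def])
    qed
    have Wc: "continuous_on UNIV (W \<omega>)" if "\<omega> \<in> space M" for \<omega>
    proof -
      have "continuous_on UNIV (\<lambda>u. Z \<omega> (u + - \<eta>))"
        by (rule continuous_on_compose2[OF Zc[OF that]]) (auto intro!: continuous_intros)
      then show ?thesis unfolding W_def by (intro continuous_on_diff continuous_on_const)
    qed
    let ?T = "{\<omega> \<in> space M. \<exists>t\<ge>real N. Z \<omega> t > sqrt (real n) * (c2 * t)}"
    let ?O1 = "{\<omega> \<in> space M. overflow b c1 c2 0 (t0 + \<eta>) (real N) (\<lambda>t. Z \<omega> t / sqrt (real n))}"
    let ?O2 = "{\<omega> \<in> space M. overflow b c1 c2 \<epsilon> (t0 + \<eta>) (t0 + 2 * \<eta>) (\<lambda>t. W \<omega> t / sqrt (real n))}"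
    let ?O3 = "{\<omega> \<in> space M. Z \<omega> \<in> osc_exceeds (rat_pairs 1 \<delta>) (sqrt (real n) * \<kappa>)}"
    let ?E = "exp (- (real n * L'))"
    have "?O3 \<in> events" by (intro gaussian_pair.osc_event[OF gp] Z countable_rat_pairs)
    then have O3: "outer_le M ?O3 ?E" by (rule outer_leI[OF _ order_refl \<delta>(2)[OF n Z]])
    have "outer_le M (?T \<union> ?O1 \<union> ?O2 \<union> ?O3) (C1 * ?E + C2 * ?E + C3 * ?E + ?E)"
      by (intro outer_le_Un C1 C2 C3 O3 n Z W) (auto intro: Zc Wc)
    moreover have "{\<omega> \<in> space M. Q2 A c1 c2 n \<omega> > real n * b} \<subseteq> ?T \<union> ?O1 \<union> ?O2 \<union> ?O3"
    proof
      fix \<omega> assume "\<omega> \<in> {\<omega> \<in> space M. Q2 A c1 c2 n \<omega> > real n * b}"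
      then have w: "\<omega> \<in> space M" and Q: "Q2 A c1 c2 n \<omega> > real n * b" by auto
      define x where "x t = Z \<omega> t / r" for t
      have Zx: "Z \<omega> t = r * x t" for t using r by (simp add: x_def)
      have xc: "continuous_on UNIV x"
        unfolding x_def using r by (intro continuous_on_divide Zc[OF w] continuous_on_const) auto
      have x0: "x 0 = 0" by (simp add: x_def Z_def A_zero[OF w])
      have sum: "(\<Sum>i<n. A i \<omega> 0 - A i \<omega> (- t)) - real n * c * t = real n * (x t - c * t)" for t c
      proof -
        have "real n * x t = - (\<Sum>i<n. A i \<omega> (- t))"
          unfolding x_def Z_def r_def[symmetric] r(2)[symmetric] using r(1) by simp
        then show ?thesis by (simp add: A_zero[OF w] sum_negf algebra_simps)
      qed
      \<comment> \<open>Taking n out of a real supremum needs boundedness, which is available only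
        off the tail event \<open>?T\<close>; hence the argument by contradiction below.\<close>
      have SUP: "(SUP t\<in>{0<..}. real n * (x t - c * t)) = real n * (SUP t\<in>{0<..}. x t - c * t)"
        if "bdd_above ((\<lambda>t. x t - c * t) ` {0<..})" for c
      proof -
        have "mono (\<lambda>y. real n * y)" by (intro monoI mult_left_mono) auto
        from continuous_at_Sup_mono[OF this _ _ that] show ?thesis
          by (simp add: image_image continuous_intros)
      qed
      show "\<omega> \<in> ?T \<union> ?O1 \<union> ?O2 \<union> ?O3"
      proof (rule ccontr)
        assume neg: "\<not> ?thesis"
        have tail: "x t \<le> c2 * t" if "t \<ge> real N" for t
        proof -
          have "\<not> Z \<omega> t > sqrt (real n) * (c2 * t)" using neg w that by blast
          then show ?thesis using r by (simp add: Zx r_def[symmetric])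
        qed
        have tail1: "x t \<le> c1 * t" if "t \<ge> real N" for t
        proof -
          have "c2 * t \<le> c1 * t" using that c12 by (intro mult_right_mono) auto
          then show ?thesis using tail[OF that] by linarith
        qed
        have bdd2: "bdd_above ((\<lambda>t. x t - c2 * t) ` {0<..})" using xc tail by (rule bdd_above_drift)
        have bdd1: "bdd_above ((\<lambda>t. x t - c1 * t) ` {0<..})" using xc tail1 by (rule bdd_above_drift)
        have "Q2 A c1 c2 n \<omega> = real n * ((SUP t\<in>{0<..}. x t - c2 * t) - (SUP s\<in>{0<..}. x s - c1 * s))"
          unfolding Q2_def sum SUP[OF bdd2] SUP[OF bdd1]
          by (rule right_diff_distrib[symmetric])
        then have "(SUP t\<in>{0<..}. x t - c2 * t) - (SUP s\<in>{0<..}. x s - c1 * s) > b"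
          using Q n by simp
        from sup_difference_exceeds[of x "real N" c2 c1 b, OF xc x0 _ _ c2 c12 b this] tail
        obtain t where t: "t > t0" "t \<le> real N" "x t \<ge> b + c2 * t" "\<And>s. s > 0 \<Longrightarrow> x t - x s \<ge> b + c2 * t - c1 * s"
          unfolding t0_def by auto
        have small: "\<bar>x u\<bar> \<le> \<epsilon> * b / 4" if "- \<eta> \<le> u" "u \<le> 0" for u
        proof (rule ccontr)
          assume "\<not> ?thesis"
          then have "sqrt (real n) * \<kappa> < r * \<bar>x u - x 0\<bar>" using r by (simp add: \<kappa>_def x0 r_def)
          also have "\<dots> = \<bar>Z \<omega> u - Z \<omega> 0\<bar>" using r by (simp add: Zx x0 abs_mult)
          finally have "Z \<omega> \<in> osc_exceeds (rat_pairs 1 \<delta>) (sqrt (real n) * \<kappa>)"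
            using that \<eta> by (intro osc_exceeds_rat_pairs[OF Zc[OF w], of u _ 0]) auto
          then show False using neg w by blast
        qed
        have "overflow b c1 c2 0 (t0 + \<eta>) (real N) x \<or>
            overflow b c1 c2 \<epsilon> (t0 + \<eta>) (t0 + 2 * \<eta>) (\<lambda>u. x (u - \<eta>) - x (- \<eta>))"
          using overflow_cases[OF b c2 c12 \<epsilon> \<eta>(1) \<eta>c, of t "real N" x] t x0 small unfolding t0_def by blast
        moreover have "x = (\<lambda>t. Z \<omega> t / sqrt (real n))"
          by (simp add: x_def[abs_def] r_def)
        moreover have "(\<lambda>u. x (u - \<eta>) - x (- \<eta>)) = (\<lambda>t. W \<omega> t / sqrt (real n))"
          by (simp add: x_def W_def r_def diff_divide_distrib)
        ultimately show False using neg w by auto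
      qed
    qed
    ultimately have "outer_le M {\<omega> \<in> space M. Q2 A c1 c2 n \<omega> > real n * b} (C1 * ?E + C2 * ?E + C3 * ?E + ?E)"
      by (rule outer_le_mono) simp
    from measure_le_outer[OF M this]
    show "measure M {\<omega> \<in> space M. Q2 A c1 c2 n \<omega> > real n * b} \<le> (C1 + C2 + C3 + 1) * ?E"
      by (simp add: distrib_right)
  qed
qed

text \<open>Since the limit defining J exists, the left-hand side with \<open>limsup\<close> is
  J.\<close>

theorem theorem3p2:
  fixes M :: "'a measure" and A :: "nat \<Rightarrow> 'a \<Rightarrow> real \<Rightarrow> real"
    and v :: "real \<Rightarrow> real" and b c1 c2 :: real
  assumes "prob_space M"
    and v_cont: "continuous_on {0..} v" and v_nonneg: "\<forall>t\<ge>0. v t \<ge> 0" and v0: "v 0 = 0"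
    and v_growth: "\<exists>\<alpha><2. ((\<lambda>t. v t / t powr \<alpha>) \<longlongrightarrow> 0) at_top"
    and A_gauss: "\<forall>i. centered_gaussian_process M (A i) (Gam v)"
    and A_cont: "\<forall>i. \<forall>\<omega>\<in>space M. continuous_on UNIV (A i \<omega>)"
    and A_zero: "\<forall>i. \<forall>\<omega>\<in>space M. A i \<omega> 0 = 0"
    and A_indep: "prob_space.indep_vars M (\<lambda>_. PiM UNIV (\<lambda>_::real. borel)) A UNIV"
    and b_pos: "b > 0" and c2_pos: "c2 > 0" and c12: "c1 > c2"
  shows "- limsup (\<lambda>n. elog (measure M {\<omega> \<in> space M. Q2 A c1 c2 n \<omega> > real n * b}) / ereal (real n))
         \<ge> (INF t\<in>{b / (c1 - c2)<..}. SUP s\<in>{0<..<t}. INF f\<in>Uset b c1 c2 s t. rateI (Gam v) f)"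
proof (rule ccontr)
  let ?l = "limsup (\<lambda>n. elog (measure M {\<omega> \<in> space M. Q2 A c1 c2 n \<omega> > real n * b}) / ereal (real n))"
  let ?r = "INF t\<in>{b / (c1 - c2)<..}. SUP s\<in>{0<..<t}. INF f\<in>Uset b c1 c2 s t. rateI (Gam v) f"
  assume "\<not> ?thesis"
  then have "- ?l < ?r" by (simp only: not_le)
  \<comment> \<open>A real level strictly between the two sides reduces the claim to a bound at one
    fixed rate, and also covers an infinite right-hand side.\<close>
  from ereal_dense2[OF this] obtain L where L: "- ?l < ereal L" "ereal L < ?r" by (elim exE conjE)
  have "\<exists>C. \<forall>n\<ge>1. measure M {\<omega> \<in> space M. Q2 A c1 c2 n \<omega> > real n * b} \<le> C * exp (- (real n * L))"
    using A_gauss A_cont A_zero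
    by (intro overflow_probability_bound[OF assms(1) v_cont v0 v_growth _ _ _ A_indep b_pos c2_pos c12 L(2)]) auto
  then obtain C where "\<And>n. n \<ge> 1 \<Longrightarrow> measure M {\<omega> \<in> space M. Q2 A c1 c2 n \<omega> > real n * b} \<le> C * exp (- (real n * L))"
    by blast
  then have "?l \<le> ereal (- L)" by (rule limsup_elog_le)
  then have "- ereal (- L) \<le> - ?l" by (simp only: ereal_minus_le_minus)
  then show False using L(1) by simp
qed

end
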